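(* Let $n\ge 4$, let $\mathbf{C}_n$ be a cycle poset with underlying crown $\mathscr{C}_n$, let $\mathcal{T}=\{(\mathbf{T}_v,r_v)\mid v\in\mathbf{C}_n\}$ be a family of rooted tree posets indexed by $\mathbf{C}_n$, and let $P$ be the unicycle poset obtained as the grafting of $\mathcal{T}$ on $\mathbf{C}_n$. Then the following three linear orders (each is one word, possibly broken over two lines) form a realizer of $P$: $$\begin{aligned} &I_{z_1}^-\, I_{x_2}^-\, A_1(X_1^-)\, X_2^+\, B_2(Z_1^+)\, C_{2n}\,\big(C_{3}\, A_4(X_3^-)\, Z_2^-\, I_{z_2}^+\big)\\ &\qquad \prod^{\nearrow}_{3\le i\le n-1}\Big(C_{2i-1}\, A_{2i}(X_{i+1}^-)\,Z_i^-\, I_{z_i}^+\, I_{x_i}^+\Big)\, B_{2n-1}(Z_n^\bullet)\, I_{x_n}^+\, I_{x_1}^+; \end{aligned}$$ $$\begin{aligned} &I_{z_2}^-\, A_3(X_2^\bullet)\,\big(I_{z_3}^-\, I_{x_3}^-\, X_{3}^+\, B_4(Z_2^+)\big)\, C_2\,\prod^{\nearrow}_{3\le i\le n-2}\Big(I_{z_{i+1}}^-\, I_{x_{i+1}}^-\, X_{i+1}^+\, B_{2i}^{2i-1}(Z_i^+)\Big)\\ &\qquad \big(I_{x_n}^-\, X_n^+\, B_{2n-2}^{2n-3}(Z_{n-1}^+)\big)\, C_{2n-1}\, A_{2n}(X_1^\bullet)\, Z_n^-\, B_1(Z_1^\bullet)\, I_{z_n}^+; \end{aligned}$$ $$\begin{aligned}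 &I_{z_n}^-\, I_{x_1}^-\, X_1^+\, A_{2n-1}(X_n^\bullet)\, B_{2n}(Z_n^+)\, C_1\,\prod^{\searrow}_{3\le i\le n-1}\Big(C_{2i}\, A_{2i-1}(X_i^\bullet)\, Z_i^\bullet\Big)\\ &\qquad C_4\, A_2(X_2^-)\, B_3(Z_2^\bullet)\, Z_1^-\, I_{z_1}^+\, I_{x_2}^+. \end{aligned}$$
   Context: All posets are finite. Linear orders on a finite set are written as words, listing elements from smallest to largest; juxtaposition is concatenation. $\prod^{\nearrow}_{a\le i\le b}w_i=w_aw_{a+1}\cdots w_b$ and $\prod^{\searrow}_{a\le i\le b}w_i=w_bw_{b-1}\cdots w_a$, both being the empty word if $b<a$. A realizer of a poset $P$ is a list of linear extensions of $P$ (repetitions allowed) such that $u\le v$ in $P$ if and only if $u\le v$ in each of them. The cover graph of a poset is its undirected Hasse diagram; a tree poset is a poset whose cover graph is a tree; a rooted tree poset is a pair $(\mathbf{T},r)$ with $\mathbf{T}$ a tree poset and $r\in\mathbf{T}$. Tree notation. Let $\mathbf{T}$ be a tree poset and $w\in\mathbf{T}$. Each $t\ne w$ is joined to $w$ by a unique path in the cover graph. $\mathbf{U}_w$ (resp. $\mathbf{D}_w$) is the set of $t\in\mathbf{T}\setminus\{w\}$ for which the path from $w$ to $t$ starts with a step to an element greater (resp. smaller) than $w$. Put $\mathbf{U}_w^+=\{t\in\mathbf{U}_w: t>w\}$, $\mathbf{U}_w^-=\mathbf{U}_w\setminus\mathbf{U}_w^+$, $\mathbf{D}_w^-=\{t\in\mathbf{D}_w: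 t<w\}$, $\mathbf{D}_w^+=\mathbf{D}_w\setminus\mathbf{D}_w^-$. Admissible words at $w$ in $\mathbf{T}$ are: linear extensions $U_w^-,U_w^+$ of $\mathbf{U}_w^-,\mathbf{U}_w^+$ and $U_{w,1},U_{w,2}$ of $\mathbf{U}_w$ such that $U_w^-\,w\,U_w^+$, $w\,U_{w,1}$, $w\,U_{w,2}$ form a realizer of $\mathbf{U}_w\cup\{w\}$; and linear extensions $D_w^-,D_w^+$ of $\mathbf{D}_w^-,\mathbf{D}_w^+$ and $D_{w,1},D_{w,2}$ of $\mathbf{D}_w$ such that $D_w^-\,w\,D_w^+$, $D_{w,1}\,w$, $D_{w,2}\,w$ form a realizer of $\mathbf{D}_w\cup\{w\}$. (Admissible words always exist.) Cycle posets. For $n\ge2$ the crown $\mathscr{C}_n$ has elements $x_1,\dots,x_n,z_1,\dots,z_n$ and strict relations exactly $x_{i+1}<z_i$ and $x_{i+1}<z_{i+1}$, for all $i$, indices taken cyclically mod $n$. A cycle poset $\mathbf{C}_n$ with underlying crown $\mathscr{C}_n$ is obtained by replacing, for each $p\in\{1,\dots,2n\}$, the cover $x_{\lfloor p/2\rfloor+1}\lessdot z_{\lceil p/2\rceil}$ by a saturated chain $x_{\lfloor p/2\rfloor+1}\lessdot y^p_1\lessdot\cdots\lessdot y^p_{k_p}\lessdot z_{\lceil p/2\rceil}$ with $k_p\ge0$ new elements. Grafting. Given a family $\{(\mathbf{T}_v,r_v)\mid v\in Q\}$ of rooted tree posets indexed by a poset $Q$, the grafting on $Q$ is the poset on $\{(v,t):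 v\in Q, t\in\mathbf{T}_v\}$ with $(a,b)\le(c,d)$ iff either $a=c$ and $b\le d$ in $\mathbf{T}_a$, or $a<c$ in $Q$, $b\le r_a$ in $\mathbf{T}_a$ and $r_c\le d$ in $\mathbf{T}_c$. We identify $v$ with $(v,r_v)$ and $\mathbf{T}_v$ with $\{v\}\times\mathbf{T}_v$, so that $v$ is the root of $\mathbf{T}_v$. Words. For every $v\in\mathbf{C}_n$ fix admissible words at $v$ in $\mathbf{T}_v$. For $w\in\{x_i,z_i\}$ put $I_w^-=U_w^-\,D_{w,1}$ and $I_w^+=U_{w,1}\,D_w^+$; put $X_i^+=x_i\,U_{x_i}^+$, $X_i^-=D_{x_i}^-\,x_i$, $X_i^\bullet=D_{x_i,2}\,x_i\,U_{x_i,2}$, and likewise $Z_i^+=z_i\,U_{z_i}^+$, $Z_i^-=D_{z_i}^-\,z_i$, $Z_i^\bullet=D_{z_i,2}\,z_i\,U_{z_i,2}$. For $p\in\{1,\dots,2n\}$ and any word $X$ put $$A_p(X)=\prod^{\searrow}_{1\le j\le k_p}\big(U_{y_j^p}^-\,D_{y_j^p,1}\big)\;X\;\prod^{\nearrow}_{1\le j\le k_p}\big(y_j^p\,U_{y_j^p}^+\big),$$ $$B_p(X)=\prod^{\nearrow}_{1\le j\le k_p}\big(D_{y_j^p}^-\,y_j^p\big)\;X\;\prod^{\searrow}_{1\le j\le k_p}\big(U_{y_j^p,1}\,D_{y_j^p}^+\big),$$ $$C_p=\prod^{\nearrow}_{1\le j\le k_p}\big(D_{y_j^p,2}\,y_j^p\,U_{y_j^p,2}\big),$$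 and $B_j^i(X)=B_i(B_j(X))$. *)

theory Defs
  imports Main
begin

section \<open>Posets, words and realizers\<close>

text \<open>A poset is given by its reflexive order relation \<open>r\<close>, so its ground set is \<^term>\<open>Field r\<close>
  and \<^term>\<open>Restr r S\<close> is the induced subposet on \<open>S\<close>.\<close>

definition word_order :: "'a list \<Rightarrow> 'a rel" where
  "word_order L = {(L ! i, L ! j) | i j. i \<le> j \<and> j < length L}"

definition linear_extension :: "'a rel \<Rightarrow> 'a list \<Rightarrow> bool" where
  "linear_extension r L \<longleftrightarrow> distinct L \<and> set L = Field r \<and> r \<subseteq> word_order L"

definition realizer :: "'a rel \<Rightarrow> 'a list list \<Rightarrow> bool" where
  "realizer r Ls \<longleftrightarrow>
     (\<forall>L \<in> set Ls. linear_extension r L) \<and>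
     (\<forall>u \<in> Field r. \<forall>v \<in> Field r. (u, v) \<in> r \<longleftrightarrow> (\<forall>L \<in> set Ls. (u, v) \<in> word_order L))"

definition covers :: "'a rel \<Rightarrow> 'a \<Rightarrow> 'a \<Rightarrow> bool" where
  "covers r u v \<longleftrightarrow> u \<noteq> v \<and> (u, v) \<in> r \<and>
     \<not> (\<exists>w. w \<noteq> u \<and> w \<noteq> v \<and> (u, w) \<in> r \<and> (w, v) \<in> r)"

definition cover_adj :: "'a rel \<Rightarrow> 'a \<Rightarrow> 'a \<Rightarrow> bool" where
  "cover_adj r u v \<longleftrightarrow> covers r u v \<or> covers r v u"

definition cover_path :: "'a rel \<Rightarrow> 'a \<Rightarrow> 'a list \<Rightarrow> 'a \<Rightarrow> bool" where
  "cover_path r u p v \<longleftrightarrow> p \<noteq> [] \<and> set p \<subseteq> Field r \<and> distinct p \<and> hd p = u \<and> last p = v \<and>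
     successively (cover_adj r) p"

definition cover_cycle :: "'a rel \<Rightarrow> 'a list \<Rightarrow> bool" where
  "cover_cycle r p \<longleftrightarrow> 3 \<le> length p \<and> distinct p \<and> successively (cover_adj r) p \<and>
     cover_adj r (last p) (hd p)"

text \<open>The cover graph is a tree: nonempty, connected and without cycles.\<close>

definition tree_poset :: "'a rel \<Rightarrow> bool" where
  "tree_poset r \<longleftrightarrow> finite r \<and> Partial_order r \<and> Field r \<noteq> {} \<and>
     (\<forall>u \<in> Field r. \<forall>v \<in> Field r. \<exists>p. cover_path r u p v) \<and> \<not> (\<exists>p. cover_cycle r p)"

definition rooted_tree_poset :: "'a rel \<Rightarrow> 'a \<Rightarrow> bool" where
  "rooted_tree_poset r t \<longleftrightarrow> tree_poset r \<and> t \<in> Field r"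


section \<open>Admissible words at an element of a tree poset\<close>

text \<open>In \<open>Uset\<close> and \<open>Dset\<close> the element \<open>p ! 1\<close> is the one reached by the first step of the path
  \<open>p\<close> from \<open>w\<close> to \<open>t\<close>; since \<open>t \<noteq> w\<close>, the path has at least two elements.\<close>

definition Uset :: "'a rel \<Rightarrow> 'a \<Rightarrow> 'a set" where
  "Uset r w = {t \<in> Field r - {w}. \<exists>p. cover_path r w p t \<and> (w, p ! 1) \<in> r}"

definition Dset :: "'a rel \<Rightarrow> 'a \<Rightarrow> 'a set" where
  "Dset r w = {t \<in> Field r - {w}. \<exists>p. cover_path r w p t \<and> (p ! 1, w) \<in> r}"

definition Uset_plus :: "'a rel \<Rightarrow> 'a \<Rightarrow> 'a set" where
  "Uset_plus r w = {t \<in> Uset r w. (w, t) \<in> r}"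

definition Uset_minus :: "'a rel \<Rightarrow> 'a \<Rightarrow> 'a set" where
  "Uset_minus r w = Uset r w - Uset_plus r w"

definition Dset_minus :: "'a rel \<Rightarrow> 'a \<Rightarrow> 'a set" where
  "Dset_minus r w = {t \<in> Dset r w. (t, w) \<in> r}"

definition Dset_plus :: "'a rel \<Rightarrow> 'a \<Rightarrow> 'a set" where
  "Dset_plus r w = Dset r w - Dset_minus r w"

text \<open>The suffixes \<open>m\<close> and \<open>p\<close> stand for the superscripts minus and plus.\<close>

record 'a tree_words =
  wUm :: "'a list"
  wUp :: "'a list"
  wU1 :: "'a list"
  wU2 :: "'a list"
  wDm :: "'a list"
  wDp :: "'a list"
  wD1 :: "'a list"
  wD2 :: "'a list"

definition admissible :: "'a rel \<Rightarrow> 'a \<Rightarrow> 'a tree_words \<Rightarrow> bool" where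
  "admissible r w W \<longleftrightarrow>
     linear_extension (Restr r (Uset_minus r w)) (wUm W) \<and>
     linear_extension (Restr r (Uset_plus r w)) (wUp W) \<and>
     linear_extension (Restr r (Uset r w)) (wU1 W) \<and>
     linear_extension (Restr r (Uset r w)) (wU2 W) \<and>
     realizer (Restr r (Uset r w \<union> {w}))
       [wUm W @ [w] @ wUp W, [w] @ wU1 W, [w] @ wU2 W] \<and>
     linear_extension (Restr r (Dset_minus r w)) (wDm W) \<and>
     linear_extension (Restr r (Dset_plus r w)) (wDp W) \<and>
     linear_extension (Restr r (Dset r w)) (wD1 W) \<and>
     linear_extension (Restr r (Dset r w)) (wD2 W) \<and>
     realizer (Restr r (Dset r w \<union> {w}))
       [wDm W @ [w] @ wDp W, wD1 W @ [w], wD2 W @ [w]]"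


section \<open>Crowns, cycle posets and grafting\<close>

text \<open>\<open>vx i\<close> and \<open>vz i\<close> are the crown elements with index \<open>i\<close>; \<open>vy p j\<close> is the \<open>j\<close>-th element of
  the chain inserted into the \<open>p\<close>-th cover.\<close>

datatype vert = vx nat | vz nat | vy nat nat

definition cyc :: "nat \<Rightarrow> nat \<Rightarrow> nat" where
  \<comment> \<open>representative in \<open>{1..n}\<close> of the index \<open>i \<ge> 1\<close> modulo \<open>n\<close>\<close>
  "cyc n i = (i - 1) mod n + 1"

definition crown :: "nat \<Rightarrow> vert rel" where
  "crown n = Id_on (vx ` {1..n} \<union> vz ` {1..n}) \<union>
     (\<Union>i \<in> {1..n}. {(vx (cyc n (i + 1)), vz i), (vx (cyc n (i + 1)), vz (cyc n (i + 1)))})"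

text \<open>The saturated chain replacing the \<open>p\<close>-th cover, from bottom to top;
  \<open>(p + 1) div 2\<close> is the ceiling of \<open>p / 2\<close>.\<close>

definition cyc_chain :: "nat \<Rightarrow> (nat \<Rightarrow> nat) \<Rightarrow> nat \<Rightarrow> vert list" where
  "cyc_chain n k p =
     vx (cyc n (p div 2 + 1)) # map (vy p) [1..<k p + 1] @ [vz ((p + 1) div 2)]"

text \<open>The order generated by the \<open>2 * n\<close> chains, where \<open>k p\<close> is the number of new elements
  in the \<open>p\<close>-th one.\<close>

definition cycle_poset :: "nat \<Rightarrow> (nat \<Rightarrow> nat) \<Rightarrow> vert rel" where
  "cycle_poset n k =
     Id_on (\<Union>p \<in> {1..2 * n}. set (cyc_chain n k p)) \<union>
     (\<Union>p \<in> {1..2 * n}. {(cyc_chain n k p ! i, cyc_chain n k p ! Suc i) | i.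
        Suc i < length (cyc_chain n k p)})\<^sup>+"

definition graft :: "'v rel \<Rightarrow> ('v \<Rightarrow> 't rel) \<Rightarrow> ('v \<Rightarrow> 't) \<Rightarrow> ('v \<times> 't) rel" where
  "graft Q T \<rho> = {((a, b), (c, d)). a \<in> Field Q \<and> c \<in> Field Q \<and>
     (a = c \<and> (b, d) \<in> T a \<or>
      a \<noteq> c \<and> (a, c) \<in> Q \<and> (b, \<rho> a) \<in> T a \<and> (\<rho> c, d) \<in> T c)}"

text \<open>With no new elements inserted, the cycle poset is the crown itself.\<close>

lemma cycle_poset_0:
  assumes "2 \<le> n"
  shows "cycle_poset n (\<lambda>_. 0) = crown n"
proof -
  let ?e = "\<lambda>p. (vx (cyc n (p div 2 + 1)), vz ((p + 1) div 2))"
  let ?R = "?e ` {1..2 * n}"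
  let ?S = "\<Union>i \<in> {1..n}. {(vx (cyc n (i + 1)), vz i), (vx (cyc n (i + 1)), vz (cyc n (i + 1)))}"
  have cyc_id: "cyc n i = i" if "1 \<le> i" "i \<le> n" for i
    using that by (auto simp: cyc_def)
  have cyc_top: "cyc n (n + 1) = 1" using assms by (simp add: cyc_def)
  have "?R \<subseteq> ?S"
  proof
    fix q assume "q \<in> ?R"
    then obtain p where p: "1 \<le> p" "p \<le> 2 * n" and q: "q = ?e p" by auto
    show "q \<in> ?S"
    proof (cases "even p")
      case True
      then obtain i where "p = 2 * i" by blast
      then show ?thesis using p q by (intro UN_I[of i]) auto
    next
      case False
      then obtain j where j: "p = 2 * j + 1" by (auto elim: oddE)
      show ?thesis
      proof (cases "j = 0")
        case True
        then show ?thesis using p q j assms cyc_top cyc_id[of 1] by (intro UN_I[of n]) auto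
      next
        case False
        then show ?thesis using p q j cyc_id[of "j + 1"] by (intro UN_I[of j]) auto
      qed
    qed
  qed
  moreover have "?S \<subseteq> ?R"
  proof
    fix q assume "q \<in> ?S"
    then obtain i where i: "1 \<le> i" "i \<le> n"
      and q: "q = (vx (cyc n (i + 1)), vz i) \<or> q = (vx (cyc n (i + 1)), vz (cyc n (i + 1)))"
      by auto
    from q show "q \<in> ?R"
    proof
      assume "q = (vx (cyc n (i + 1)), vz i)"
      then show ?thesis using i by (intro image_eqI[of _ _ "2 * i"]) auto
    next
      assume q2: "q = (vx (cyc n (i + 1)), vz (cyc n (i + 1)))"
      show ?thesis
      proof (cases "i = n")
        case True
        then show ?thesis using q2 assms cyc_top cyc_id[of 1]
          by (intro image_eqI[of _ _ 1]) auto
      next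
        case False
        then show ?thesis using q2 i cyc_id[of "i + 1"]
          by (intro image_eqI[of _ _ "2 * i + 1"]) auto
      qed
    qed
  qed
  ultimately have RS: "?R = ?S" by blast
  have chain: "cyc_chain n (\<lambda>_. 0) p = [fst (?e p), snd (?e p)]" for p
    by (simp add: cyc_chain_def)
  have "(\<Union>p \<in> {1..2 * n}. {(cyc_chain n (\<lambda>_. 0) p ! i, cyc_chain n (\<lambda>_. 0) p ! Suc i) | i.
      Suc i < length (cyc_chain n (\<lambda>_. 0) p)}) = ?R"
    unfolding chain by auto
  moreover have "?R\<^sup>+ = ?R"
    by (rule trancl_id) (auto simp: trans_def)
  moreover have "(\<Union>p \<in> {1..2 * n}. set (cyc_chain n (\<lambda>_. 0) p)) = vx ` {1..n} \<union> vz ` {1..n}"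
    (is "?V = ?V'")
  proof
    have "set (cyc_chain n (\<lambda>_. 0) p) \<subseteq> ?V'" if "p \<in> {1..2 * n}" for p
    proof -
      have "cyc n (p div 2 + 1) \<in> {1..n}"
        using assms mod_less_divisor[of n "p div 2"] by (simp add: cyc_def Suc_le_eq)
      moreover have "(p + 1) div 2 \<in> {1..n}" using that by auto
      ultimately show ?thesis unfolding chain by simp
    qed
    then show "?V \<subseteq> ?V'" by (rule UN_least)
  next
    have "{vx i, vz i} \<subseteq> ?V" if "i \<in> {1..n}" for i
    proof -
      have eq: "(2 * i - 1) div 2 + 1 = i" "(2 * i - 1 + 1) div 2 = i" and p: "2 * i - 1 \<in> {1..2 * n}"
        using that by auto
      have "cyc n i = i" using that cyc_id[of i] by simp
      then have "{vx i, vz i} = set (cyc_chain n (\<lambda>_. 0) (2 * i - 1))"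
        unfolding chain eq by simp
      then show ?thesis using p by blast
    qed
    then show "?V' \<subseteq> ?V" by blast
  qed
  ultimately show ?thesis
    unfolding cycle_poset_def crown_def using RS by simp
qed


section \<open>The three words\<close>

definition prod_up :: "nat \<Rightarrow> nat \<Rightarrow> (nat \<Rightarrow> 'a list) \<Rightarrow> 'a list" where
  "prod_up a b w = concat (map w [a..<b + 1])"

definition prod_down :: "nat \<Rightarrow> nat \<Rightarrow> (nat \<Rightarrow> 'a list) \<Rightarrow> 'a list" where
  "prod_down a b w = concat (map w (rev [a..<b + 1]))"

text \<open>\<open>W v\<close> consists of words over the tree poset at \<open>v\<close>, whose root is \<open>\<rho> v\<close>; prefixing \<open>v\<close>
  moves them to the copy of that tree in the grafting.  The words \<open>X\<^sub>i\<close> and \<open>Z\<^sub>i\<close> with superscript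
  plus, minus or bullet are \<open>V_plus\<close>, \<open>V_minus\<close>, \<open>V_bullet\<close> at \<open>vx i\<close> and \<open>vz i\<close>.\<close>

context
  fixes k :: "nat \<Rightarrow> nat" and \<rho> :: "vert \<Rightarrow> 't" and W :: "vert \<Rightarrow> 't tree_words"
begin

definition V_root :: "vert \<Rightarrow> (vert \<times> 't) list" where "V_root v = [(v, \<rho> v)]"

definition U_minus :: "vert \<Rightarrow> (vert \<times> 't) list" where "U_minus v = map (Pair v) (wUm (W v))"
definition U_plus :: "vert \<Rightarrow> (vert \<times> 't) list" where "U_plus v = map (Pair v) (wUp (W v))"
definition U_1 :: "vert \<Rightarrow> (vert \<times> 't) list" where "U_1 v = map (Pair v) (wU1 (W v))"
definition U_2 :: "vert \<Rightarrow> (vert \<times> 't) list" where "U_2 v = map (Pair v) (wU2 (W v))"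
definition D_minus :: "vert \<Rightarrow> (vert \<times> 't) list" where "D_minus v = map (Pair v) (wDm (W v))"
definition D_plus :: "vert \<Rightarrow> (vert \<times> 't) list" where "D_plus v = map (Pair v) (wDp (W v))"
definition D_1 :: "vert \<Rightarrow> (vert \<times> 't) list" where "D_1 v = map (Pair v) (wD1 (W v))"
definition D_2 :: "vert \<Rightarrow> (vert \<times> 't) list" where "D_2 v = map (Pair v) (wD2 (W v))"

definition I_minus :: "vert \<Rightarrow> (vert \<times> 't) list" where "I_minus v = U_minus v @ D_1 v"
definition I_plus :: "vert \<Rightarrow> (vert \<times> 't) list" where "I_plus v = U_1 v @ D_plus v"

definition V_plus :: "vert \<Rightarrow> (vert \<times> 't) list" where "V_plus v = V_root v @ U_plus v"
definition V_minus :: "vert \<Rightarrow> (vert \<times> 't) list" where "V_minus v = D_minus v @ V_root v"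
definition V_bullet :: "vert \<Rightarrow> (vert \<times> 't) list" where "V_bullet v = D_2 v @ V_root v @ U_2 v"

definition A_word :: "nat \<Rightarrow> (vert \<times> 't) list \<Rightarrow> (vert \<times> 't) list" where
  "A_word p w =
     prod_down 1 (k p) (\<lambda>j. U_minus (vy p j) @ D_1 (vy p j)) @ w @
     prod_up 1 (k p) (\<lambda>j. V_root (vy p j) @ U_plus (vy p j))"

definition B_word :: "nat \<Rightarrow> (vert \<times> 't) list \<Rightarrow> (vert \<times> 't) list" where
  "B_word p w =
     prod_up 1 (k p) (\<lambda>j. D_minus (vy p j) @ V_root (vy p j)) @ w @
     prod_down 1 (k p) (\<lambda>j. U_1 (vy p j) @ D_plus (vy p j))"

definition C_word :: "nat \<Rightarrow> (vert \<times> 't) list" where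
  "C_word p = prod_up 1 (k p) (\<lambda>j. D_2 (vy p j) @ V_root (vy p j) @ U_2 (vy p j))"

definition BB_word :: "nat \<Rightarrow> nat \<Rightarrow> (vert \<times> 't) list \<Rightarrow> (vert \<times> 't) list" where
  \<comment> \<open>the first argument is the superscript, the second one the subscript\<close>
  "BB_word i j w = B_word i (B_word j w)"

definition word1 :: "nat \<Rightarrow> (vert \<times> 't) list" where
  "word1 n =
     I_minus (vz 1) @ I_minus (vx 2) @ A_word 1 (V_minus (vx 1)) @ V_plus (vx 2) @
     B_word 2 (V_plus (vz 1)) @ C_word (2 * n) @
     (C_word 3 @ A_word 4 (V_minus (vx 3)) @ V_minus (vz 2) @ I_plus (vz 2)) @
     prod_up 3 (n - 1) (\<lambda>i.
       C_word (2 * i - 1) @ A_word (2 * i) (V_minus (vx (i + 1))) @ V_minus (vz i) @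
       I_plus (vz i) @ I_plus (vx i)) @
     B_word (2 * n - 1) (V_bullet (vz n)) @ I_plus (vx n) @ I_plus (vx 1)"

definition word2 :: "nat \<Rightarrow> (vert \<times> 't) list" where
  "word2 n =
     I_minus (vz 2) @ A_word 3 (V_bullet (vx 2)) @
     (I_minus (vz 3) @ I_minus (vx 3) @ V_plus (vx 3) @ B_word 4 (V_plus (vz 2))) @ C_word 2 @
     prod_up 3 (n - 2) (\<lambda>i.
       I_minus (vz (i + 1)) @ I_minus (vx (i + 1)) @ V_plus (vx (i + 1)) @
       BB_word (2 * i - 1) (2 * i) (V_plus (vz i))) @
     (I_minus (vx n) @ V_plus (vx n) @
       BB_word (2 * n - 3) (2 * n - 2) (V_plus (vz (n - 1)))) @
     C_word (2 * n - 1) @ A_word (2 * n) (V_bullet (vx 1)) @ V_minus (vz n) @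
     B_word 1 (V_bullet (vz 1)) @ I_plus (vz n)"

definition word3 :: "nat \<Rightarrow> (vert \<times> 't) list" where
  "word3 n =
     I_minus (vz n) @ I_minus (vx 1) @ V_plus (vx 1) @ A_word (2 * n - 1) (V_bullet (vx n)) @
     B_word (2 * n) (V_plus (vz n)) @ C_word 1 @
     prod_down 3 (n - 1) (\<lambda>i.
       C_word (2 * i) @ A_word (2 * i - 1) (V_bullet (vx i)) @ V_bullet (vz i)) @
     C_word 4 @ A_word 2 (V_minus (vx 2)) @ B_word 3 (V_bullet (vz 2)) @ V_minus (vz 1) @
     I_plus (vz 1) @ I_plus (vx 2)"

end

end

theory Submission
  imports Defs "HOL-Library.Product_Lexorder"
begin

text \<open>The three words read the tree at each vertex \<open>v\<close> of the cycle in three different ways, which are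
called shapes here.  In one word the tree is read as \<open>U\<^sup>- D\<^sub>1\<close> and later \<open>v U\<^sup>+\<close> (shape \<open>Late\<close>: the root
comes with the second piece), in another as \<open>D\<^sup>- v\<close> and later \<open>U\<^sub>1 D\<^sup>+\<close> (shape \<open>Early\<close>), and in the
remaining one as the single factor \<open>D\<^sub>2 v U\<^sub>2\<close> (shape \<open>Whole\<close>).

Inside one tree these three words realize the tree order (\<open>rel_iff_in_three_words\<close>): restricted to
\<open>U\<close> and the root, or to \<open>D\<close> and the root, they are the words of the admissible realizers, and a
pair in \<open>D \<times> U\<close> is comparable exactly if it is comparable through the root, because the tree falls
apart when the root is deleted.

Between the trees of two vertices \<open>a\<close> and \<open>c\<close> only the span of each vertex matters, that is the
stretch of the word from its first to its last piece, together with the place of the piece that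
contains the root.  If \<open>a < c\<close>, three things suffice: the root piece of \<open>a\<close> precedes the one of \<open>c\<close>
in every word; where \<open>a\<close> is \<open>Early\<close>, its second piece follows everything of \<open>c\<close>, which keeps the
elements of \<open>T\<^sub>a\<close> not below the root of \<open>a\<close> incomparable to \<open>T\<^sub>c\<close>; where \<open>c\<close> is \<open>Late\<close>, its first piece
precedes everything of \<open>a\<close>, for the dual reason.  If \<open>a\<close> and \<open>c\<close> are incomparable, it suffices that
each span lies entirely to the left of the other one in some word.  This is
\<open>layouts_realize_graft\<close>; it reduces the problem to comparing places of spans, and the admissible
words drop out of sight.

The places are given by explicit tables.  Each word is built around a product whose factors all
look alike, so up to finitely many exceptional vertices the place of a piece is an affine function
of the index, and the new elements of one chain can share a place because inside it they are
ordered by their height.  The conditions on the spans become finitely many linear inequalities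
between table entries (\<open>below_blocks\<close>, \<open>parallel_blocks\<close>), and it remains to see that the words do
list the pieces in the order of the tables (\<open>tokens1_chunk\<close>, \<open>tokens2_chunk\<close>, \<open>tokens3_chunk\<close>) and
omit none (\<open>tokens1_complete\<close>, \<open>tokens2_complete\<close>, \<open>tokens3_complete\<close>).\<close>

section \<open>The order of a concatenation\<close>

lemma word_order_Nil [simp]: "word_order [] = {}"
  by (simp add: word_order_def)

lemma word_order_subset: "word_order L \<subseteq> set L \<times> set L"
  by (force simp: word_order_def)

lemma word_order_append:
  "word_order (xs @ ys) = word_order xs \<union> word_order ys \<union> set xs \<times> set ys"
proof (intro equalityI subrelI)
  fix a b assume "(a, b) \<in> word_order (xs @ ys)"
  then obtain i j where ij: "i \<le> j" "j < length (xs @ ys)" "a = (xs @ ys) ! i" "b = (xs @ ys) ! j"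
    by (auto simp: word_order_def)
  consider "j < length xs" | "i < length xs" "length xs \<le> j" | "length xs \<le> i" by linarith
  then show "(a, b) \<in> word_order xs \<union> word_order ys \<union> set xs \<times> set ys"
  proof cases
    case 1
    with ij have "(a, b) \<in> word_order xs" by (auto simp: word_order_def nth_append)
    then show ?thesis by blast
  next
    case 2
    with ij show ?thesis by (auto simp: nth_append)
  next
    case 3
    with ij have "a = ys ! (i - length xs)" "b = ys ! (j - length xs)"
      "i - length xs \<le> j - length xs" "j - length xs < length ys"
      by (auto simp: nth_append)
    then have "(a, b) \<in> word_order ys" by (auto simp: word_order_def)
    then show ?thesis by blast
  qed
next
  fix a b assume "(a, b) \<in> word_order xs \<union> word_order ys \<union> set xs \<times> set ys"
  then consider "(a, b) \<in> word_order xs" | "(a, b) \<in> word_order ys" | "a \<in> set xs" "b \<in> set ys"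
    by blast
  then show "(a, b) \<in> word_order (xs @ ys)"
  proof cases
    case 1
    then obtain i j where "i \<le> j" "j < length xs" "a = xs ! i" "b = xs ! j"
      by (auto simp: word_order_def)
    then show ?thesis unfolding word_order_def
      by (intro CollectI exI[of _ i] exI[of _ j]) (auto simp: nth_append)
  next
    case 2
    then obtain i j where "i \<le> j" "j < length ys" "a = ys ! i" "b = ys ! j"
      by (auto simp: word_order_def)
    then show ?thesis unfolding word_order_def
      by (intro CollectI exI[of _ "length xs + i"] exI[of _ "length xs + j"]) auto
  next
    case 3
    then obtain i j where "i < length xs" "j < length ys" "a = xs ! i" "b = ys ! j"
      by (auto simp: in_set_conv_nth)
    then show ?thesis unfolding word_order_def
      by (intro CollectI exI[of _ i] exI[of _ "length xs + j"]) (auto simp: nth_append)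
  qed
qed

lemma word_order_appendI: "a \<in> set xs \<Longrightarrow> b \<in> set ys \<Longrightarrow> (a, b) \<in> word_order (xs @ ys)"
  by (simp add: word_order_append)

lemma word_order_append_notin:
  "a \<notin> set xs \<Longrightarrow> b \<notin> set ys \<Longrightarrow> (a, b) \<notin> word_order (xs @ ys)"
  using word_order_subset[of xs] word_order_subset[of ys] by (auto simp: word_order_append)

lemma word_order_drop_middle:
  assumes "{a, b} \<inter> set ys = {}"
  shows "(a, b) \<in> word_order (xs @ ys @ zs) \<longleftrightarrow> (a, b) \<in> word_order (xs @ zs)"
  using word_order_subset[of ys] assms by (auto simp: word_order_append)

lemma word_order_Cons: "word_order (x # xs) = insert (x, x) ({x} \<times> set xs) \<union> word_order xs"
proof -
  have "word_order [x] = {(x, x)}" by (auto simp: word_order_def)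
  then show ?thesis using word_order_append[of "[x]" xs] by auto
qed

lemma word_order_map_Pair:
  "((v, s), (v, t)) \<in> word_order (map (Pair v) L) \<longleftrightarrow> (s, t) \<in> word_order L"
  by (induction L) (auto simp: word_order_Cons)

text \<open>If the factors of a word come in increasing order of a key, then the order of two letters is
decided by the keys of their factors, and by the order inside the factor when both lie in the same
one.\<close>

lemma word_order_concat_sorted:
  fixes key :: "'s \<Rightarrow> 'o::order"
  assumes "sorted_wrt (\<lambda>s t. key s < key t) ts"
  shows "(a, b) \<in> word_order (concat (map f ts)) \<longleftrightarrow>
    (\<exists>t \<in> set ts. (a, b) \<in> word_order (f t)) \<or>
    (\<exists>s \<in> set ts. \<exists>t \<in> set ts. key s < key t \<and> a \<in> set (f s) \<and> b \<in> set (f t))"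
  using assms
proof (induction ts)
  case (Cons s ts)
  have first: "key s < key t" if "t \<in> set ts" for t
    using Cons.prems that by simp
  have not_first: "\<not> key t < key s" if "t \<in> set (s # ts)" for t
    using first that by (auto dest: less_asym)
  have IH: "(a, b) \<in> word_order (concat (map f ts)) \<longleftrightarrow>
      (\<exists>t \<in> set ts. (a, b) \<in> word_order (f t)) \<or>
      (\<exists>x \<in> set ts. \<exists>t \<in> set ts. key x < key t \<and> a \<in> set (f x) \<and> b \<in> set (f t))"
    using Cons by simp
  have pairs: "(\<exists>x \<in> set (s # ts). \<exists>t \<in> set (s # ts). key x < key t \<and> a \<in> set (f x) \<and> b \<in> set (f t)) \<longleftrightarrow>
      (\<exists>t \<in> set ts. a \<in> set (f s) \<and> b \<in> set (f t)) \<or>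
      (\<exists>x \<in> set ts. \<exists>t \<in> set ts. key x < key t \<and> a \<in> set (f x) \<and> b \<in> set (f t))"
    using not_first[of s] not_first first by (simp only: list.set) blast
  have "(a, b) \<in> word_order (concat (map f (s # ts))) \<longleftrightarrow>
      (a, b) \<in> word_order (f s) \<or> (a, b) \<in> word_order (concat (map f ts)) \<or>
      (\<exists>t \<in> set ts. a \<in> set (f s) \<and> b \<in> set (f t))"
    by (auto simp: word_order_append)
  then show ?case unfolding pairs IH by (simp only: list.set) blast
qed simp

lemma distinct_concat_map:
  assumes "distinct ts" and "\<And>t. t \<in> set ts \<Longrightarrow> distinct (f t)"
    and "\<And>s t x. s \<in> set ts \<Longrightarrow> t \<in> set ts \<Longrightarrow> x \<in> set (f s) \<Longrightarrow> x \<in> set (f t) \<Longrightarrow> s = t"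
  shows "distinct (concat (map f ts))"
  using assms
proof (induction ts)
  case (Cons s ts)
  have "distinct (concat (map f ts))"
    by (rule Cons.IH) (use Cons.prems in auto)
  moreover have "set (f s) \<inter> set (concat (map f ts)) = {}"
  proof -
    have "x \<notin> set (f t)" if "x \<in> set (f s)" "t \<in> set ts" for x t
      using Cons.prems(1) Cons.prems(3)[of s t x] that by auto
    then show ?thesis by auto
  qed
  ultimately show ?case using Cons.prems(2) by simp
qed simp


section \<open>Rooted tree posets\<close>

lemma cover_adj_commute: "cover_adj r u v \<longleftrightarrow> cover_adj r v u"
  by (auto simp: cover_adj_def)

text \<open>Membership in one component of the cover graph after deletion of \<open>w\<close>.\<close>

definition linked_avoiding :: "'a rel \<Rightarrow> 'a \<Rightarrow> 'a rel" where
  "linked_avoiding r w = {(u, v). cover_adj r u v \<and> u \<noteq> w \<and> v \<noteq> w}\<^sup>*"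

lemma linked_avoiding_commute:
  "(u, v) \<in> linked_avoiding r w \<Longrightarrow> (v, u) \<in> linked_avoiding r w"
  unfolding linked_avoiding_def
  by (rule symD[OF sym_rtrancl]) (auto simp: sym_def cover_adj_commute)

lemma linked_avoiding_trans:
  "(u, v) \<in> linked_avoiding r w \<Longrightarrow> (v, x) \<in> linked_avoiding r w \<Longrightarrow> (u, x) \<in> linked_avoiding r w"
  unfolding linked_avoiding_def by (rule rtrancl_trans)

lemma rtrancl_imp_distinct_path:
  assumes "(a, b) \<in> R\<^sup>*"
  shows "\<exists>p. p \<noteq> [] \<and> distinct p \<and> hd p = a \<and> last p = b \<and> successively (\<lambda>u v. (u, v) \<in> R) p"
  using assms
proof (induction rule: rtrancl_induct)
  case base
  show ?case by (rule exI[of _ "[a]"]) simp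
next
  case (step y z)
  then obtain p where p: "p \<noteq> []" "distinct p" "hd p = a" "last p = y"
    "successively (\<lambda>u v. (u, v) \<in> R) p" by blast
  show ?case
  proof (cases "z \<in> set p")
    case True
    then obtain p1 p2 where "p = p1 @ z # p2" by (auto simp: in_set_conv_decomp)
    then have "p1 @ [z] \<noteq> [] \<and> distinct (p1 @ [z]) \<and> hd (p1 @ [z]) = a \<and> last (p1 @ [z]) = z \<and>
        successively (\<lambda>u v. (u, v) \<in> R) (p1 @ [z])"
      using p by (auto simp: successively_append_iff hd_append)
    then show ?thesis by blast
  next
    case False
    then have "p @ [z] \<noteq> [] \<and> distinct (p @ [z]) \<and> hd (p @ [z]) = a \<and> last (p @ [z]) = z \<and>
        successively (\<lambda>u v. (u, v) \<in> R) (p @ [z])"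
      using p step.hyps by (auto simp: successively_append_iff)
    then show ?thesis by blast
  qed
qed

lemma linked_avoiding_path:
  assumes "(a, b) \<in> linked_avoiding r w" "a \<noteq> w" "a \<in> Field r"
  obtains p where "p \<noteq> []" "distinct p" "hd p = a" "last p = b" "successively (cover_adj r) p"
    "w \<notin> set p" "set p \<subseteq> Field r"
proof -
  obtain p where p: "p \<noteq> []" "distinct p" "hd p = a" "last p = b"
    "successively (\<lambda>u v. (u, v) \<in> {(u, v). cover_adj r u v \<and> u \<noteq> w \<and> v \<noteq> w}) p"
    using rtrancl_imp_distinct_path[OF assms(1)[unfolded linked_avoiding_def]] by blast
  have "w \<notin> set q \<and> set q \<subseteq> Field r"
    if "q \<noteq> []" "hd q \<noteq> w" "hd q \<in> Field r"
      "successively (\<lambda>u v. (u, v) \<in> {(u, v). cover_adj r u v \<and> u \<noteq> w \<and> v \<noteq> w}) q" for q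
    using that
  proof (induction q)
    case (Cons x q)
    show ?case
    proof (cases q)
      case (Cons y q')
      with Cons.prems have "y \<noteq> w" "y \<in> Field r" 
        by (auto simp: cover_adj_def covers_def Field_def)
      then show ?thesis using Cons.IH Cons.prems Cons by auto
    qed (use Cons.prems in auto)
  qed simp
  from this[of p] p assms(2,3) have "w \<notin> set p" "set p \<subseteq> Field r" by auto
  moreover have "successively (cover_adj r) p"
    by (rule successively_mono[OF p(5)]) auto
  ultimately show thesis using that[of p] p by blast
qed

text \<open>A path between two neighbours of \<open>w\<close> that avoids \<open>w\<close> closes up to a cycle through \<open>w\<close>.\<close>

lemma no_link_between_neighbours:
  assumes "\<not> (\<exists>p. cover_cycle r p)" "cover_adj r w a" "cover_adj r w b" "a \<noteq> b"
  shows "(a, b) \<notin> linked_avoiding r w"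
proof
  assume "(a, b) \<in> linked_avoiding r w"
  moreover have "a \<noteq> w" "a \<in> Field r" using assms(2) by (auto simp: cover_adj_def covers_def Field_def)
  ultimately obtain p where p: "p \<noteq> []" "distinct p" "hd p = a" "last p = b"
    "successively (cover_adj r) p" "w \<notin> set p"
    by (rule linked_avoiding_path)
  have "2 \<le> length p"
    using p(1,3,4) assms(4) by (cases p rule: remdups_adj.cases) auto
  then have "cover_cycle r (w # p)"
    using p assms(2,3) by (auto simp: cover_cycle_def successively_Cons cover_adj_commute)
  then show False using assms(1) by blast
qed

lemma covers_converse: "covers (r\<inverse>) u v \<longleftrightarrow> covers r v u"
  by (auto simp: covers_def)

lemma cover_adj_converse: "cover_adj (r\<inverse>) = cover_adj r"
  by (auto simp: cover_adj_def covers_converse fun_eq_iff)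

lemma Uset_converse: "Uset (r\<inverse>) w = Dset r w"
  by (simp add: Uset_def Dset_def cover_path_def cover_adj_converse)

lemma tree_poset_converse: "tree_poset r \<Longrightarrow> tree_poset (r\<inverse>)"
  by (simp add: tree_poset_def cover_path_def cover_cycle_def cover_adj_converse)

lemma linked_avoiding_converse: "linked_avoiding (r\<inverse>) w = linked_avoiding r w"
  by (simp add: linked_avoiding_def cover_adj_converse)

text \<open>In a finite poset the pairs of comparable elements are connected by saturated chains.  The chain is
kept inside the interval from \<open>a\<close> to \<open>b\<close>, so that it misses every element outside this interval.\<close>

lemma rel_imp_covers_chain:
  assumes "finite r" "Partial_order r" "(a, b) \<in> r"
  shows "(a, b) \<in> {(u, v). covers r u v \<and> (a, u) \<in> r \<and> (v, b) \<in> r}\<^sup>*"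
  using assms(3)
proof (induction "card {x. (a, x) \<in> r \<and> (x, b) \<in> r}" arbitrary: a b rule: less_induct)
  case less
  have trans: "trans r" and antisym: "antisym r" and refl: "refl_on (Field r) r"
    using assms(2) by (auto simp: partial_order_on_def preorder_on_def)
  have F: "a \<in> Field r" "b \<in> Field r" using less.prems by (auto simp: Field_def)
  then have rr: "(a, a) \<in> r" "(b, b) \<in> r" using refl by (auto dest: refl_onD)
  show ?case
  proof (cases "a = b \<or> covers r a b")
    case True
    then show ?thesis using rr by auto
  next
    case False
    then obtain c where c: "c \<noteq> a" "c \<noteq> b" "(a, c) \<in> r" "(c, b) \<in> r"
      using less.prems by (auto simp: covers_def)
    have fin: "finite {x. (a, x) \<in> r \<and> (x, b) \<in> r}"
      by (rule finite_subset[OF _ finite_Field[OF assms(1)]]) (auto intro: FieldI1)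
    have "{x. (a, x) \<in> r \<and> (x, c) \<in> r} \<subset> {x. (a, x) \<in> r \<and> (x, b) \<in> r}"
    proof
      show "{x. (a, x) \<in> r \<and> (x, c) \<in> r} \<subseteq> {x. (a, x) \<in> r \<and> (x, b) \<in> r}"
        using c trans by (auto dest: transD)
      have "(b, c) \<notin> r" using c antisym by (auto dest: antisymD)
      then show "{x. (a, x) \<in> r \<and> (x, c) \<in> r} \<noteq> {x. (a, x) \<in> r \<and> (x, b) \<in> r}"
        using less.prems rr by blast
    qed
    then have 1: "(a, c) \<in> {(u, v). covers r u v \<and> (a, u) \<in> r \<and> (v, c) \<in> r}\<^sup>*"
      by (rule less.hyps[OF psubset_card_mono[OF fin] c(3)])
    have "{x. (c, x) \<in> r \<and> (x, b) \<in> r} \<subset> {x. (a, x) \<in> r \<and> (x, b) \<in> r}"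
    proof
      show "{x. (c, x) \<in> r \<and> (x, b) \<in> r} \<subseteq> {x. (a, x) \<in> r \<and> (x, b) \<in> r}"
        using c trans by (auto dest: transD)
      have "(c, a) \<notin> r" using c antisym by (auto dest: antisymD)
      then show "{x. (c, x) \<in> r \<and> (x, b) \<in> r} \<noteq> {x. (a, x) \<in> r \<and> (x, b) \<in> r}"
        using less.prems rr by blast
    qed
    then have 2: "(c, b) \<in> {(u, v). covers r u v \<and> (c, u) \<in> r \<and> (v, b) \<in> r}\<^sup>*"
      by (rule less.hyps[OF psubset_card_mono[OF fin] c(4)])
    let ?R = "{(u, v). covers r u v \<and> (a, u) \<in> r \<and> (v, b) \<in> r}"
    have "(a, c) \<in> ?R\<^sup>*"
      by (rule subsetD[OF rtrancl_mono 1]) (use c trans in \<open>auto dest: transD\<close>)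
    moreover have "(c, b) \<in> ?R\<^sup>*"
      by (rule subsetD[OF rtrancl_mono 2]) (use c trans in \<open>auto dest: transD\<close>)
    ultimately show ?thesis by (rule rtrancl_trans)
  qed
qed

lemma rel_imp_linked_avoiding:
  assumes "finite r" "Partial_order r" "(a, b) \<in> r" "\<not> ((a, w) \<in> r \<and> (w, b) \<in> r)"
  shows "(a, b) \<in> linked_avoiding r w"
proof -
  have "trans r" using assms(2) by (auto simp: partial_order_on_def preorder_on_def)
  then have "{(u, v). covers r u v \<and> (a, u) \<in> r \<and> (v, b) \<in> r} \<subseteq>
      {(u, v). cover_adj r u v \<and> u \<noteq> w \<and> v \<noteq> w}"
    using assms(4) by (auto simp: cover_adj_def covers_def dest: transD)
  then show ?thesis
    unfolding linked_avoiding_def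
    by (rule subsetD[OF rtrancl_mono rel_imp_covers_chain[OF assms(1-3)]])
qed

lemma
  assumes "tree_poset r"
  shows tree_trans: "(x, y) \<in> r \<Longrightarrow> (y, z) \<in> r \<Longrightarrow> (x, z) \<in> r"
    and tree_antisym: "(x, y) \<in> r \<Longrightarrow> (y, x) \<in> r \<Longrightarrow> x = y"
    and tree_refl: "x \<in> Field r \<Longrightarrow> (x, x) \<in> r"
    and tree_finite: "finite r" and tree_po: "Partial_order r"
    and tree_acyclic: "\<not> (\<exists>p. cover_cycle r p)"
  using assms by (auto simp: tree_poset_def partial_order_on_def preorder_on_def
      dest: transD antisymD refl_onD)

context
  fixes r :: "'a rel" and w :: 'a
  assumes tree: "tree_poset r" and root: "w \<in> Field r"
begin

text \<open>Describing \<open>Uset\<close> by components instead of paths makes it visibly closed under steps that do not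
pass through \<open>w\<close>.\<close>

lemma Uset_iff_linked:
  "t \<in> Uset r w \<longleftrightarrow> (\<exists>a. covers r w a \<and> (a, t) \<in> linked_avoiding r w)"
proof
  assume "t \<in> Uset r w"
  then obtain p where p: "cover_path r w p t" and up: "(w, p ! 1) \<in> r" and t: "t \<noteq> w"
    by (auto simp: Uset_def)
  obtain a q where q: "p = w # a # q"
    using p t by (cases p rule: remdups_adj.cases) (auto simp: cover_path_def)
  have "covers r w a"
    using p up q tree_antisym[OF tree, of w a] by (auto simp: cover_path_def cover_adj_def covers_def)
  moreover have "(hd s, last s) \<in> linked_avoiding r w"
    if "successively (cover_adj r) s" "w \<notin> set s" "s \<noteq> []" for s
    using that
  proof (induction s rule: induct_list012)
    case (3 x y zs)
    then have "(x, y) \<in> linked_avoiding r w" "(y, last (y # zs)) \<in> linked_avoiding r w"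
      by (auto simp: linked_avoiding_def)
    then show ?case by (auto intro: linked_avoiding_trans)
  qed (auto simp: linked_avoiding_def)
  from this[of "a # q"] have "(a, t) \<in> linked_avoiding r w"
    using p q by (auto simp: cover_path_def)
  ultimately show "\<exists>a. covers r w a \<and> (a, t) \<in> linked_avoiding r w" by blast
next
  assume "\<exists>a. covers r w a \<and> (a, t) \<in> linked_avoiding r w"
  then obtain a where a: "covers r w a" "(a, t) \<in> linked_avoiding r w" by blast
  then have "a \<noteq> w" "a \<in> Field r" by (auto simp: covers_def Field_def)
  with a(2) obtain p where p: "p \<noteq> []" "distinct p" "hd p = a" "last p = t"
    "successively (cover_adj r) p" "w \<notin> set p" "set p \<subseteq> Field r"
    by (rule linked_avoiding_path)
  then have "cover_path r w (w # p) t"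
    using a root by (auto simp: cover_path_def successively_Cons cover_adj_def)
  moreover have "(w # p) ! 1 = a" using p by (cases p) auto
  moreover have "t \<in> Field r - {w}" using p by (metis Diff_iff last_in_set singletonD subsetD)
  ultimately show "t \<in> Uset r w"
    using a(1) unfolding Uset_def covers_def by fastforce
qed

lemma Uset_linked:
  "t \<in> Uset r w \<Longrightarrow> (t, s) \<in> linked_avoiding r w \<Longrightarrow> s \<in> Uset r w"
  unfolding Uset_iff_linked by (blast intro: linked_avoiding_trans)

lemma greater_in_Uset:
  assumes "(w, t) \<in> r" "t \<noteq> w"
  shows "t \<in> Uset r w"
proof -
  have "(w, t) \<in> {(u, v). covers r u v \<and> (w, u) \<in> r \<and> (v, t) \<in> r}\<^sup>*"
    by (rule rel_imp_covers_chain[OF tree_finite[OF tree] tree_po[OF tree] assms(1)])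
  then obtain a where a: "covers r w a" "(a, t) \<in> r"
    using assms(2) by (auto elim: converse_rtranclE)
  then have "(a, w) \<notin> r" using tree_antisym[OF tree, of w a] by (auto simp: covers_def)
  then have "(a, t) \<in> linked_avoiding r w"
    using rel_imp_linked_avoiding[OF tree_finite[OF tree] tree_po[OF tree] a(2)] by blast
  then show ?thesis using a Uset_iff_linked by blast
qed

end

context
  fixes r :: "'a rel" and w :: 'a
  assumes tree: "tree_poset r" and root: "w \<in> Field r"
begin

text \<open>Reversing the order exchanges \<open>Uset\<close> and \<open>Dset\<close> and leaves the cover graph alone, so the statements
about \<open>Dset\<close> are those about \<open>Uset\<close> for the converse relation.\<close>

lemma Dset_iff_linked:
  "t \<in> Dset r w \<longleftrightarrow> (\<exists>a. covers r a w \<and> (a, t) \<in> linked_avoiding r w)"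
  using Uset_iff_linked[OF tree_poset_converse[OF tree], of w t] root
  by (simp add: Uset_converse covers_converse linked_avoiding_converse)

lemma smaller_in_Dset: "(t, w) \<in> r \<Longrightarrow> t \<noteq> w \<Longrightarrow> t \<in> Dset r w"
  using greater_in_Uset[OF tree_poset_converse[OF tree], of w t] root
  by (simp add: Uset_converse)

lemma Uset_Dset_disjoint: "Uset r w \<inter> Dset r w = {}"
proof (rule ccontr)
  assume "Uset r w \<inter> Dset r w \<noteq> {}"
  then obtain t a b where ab: "covers r w a" "(a, t) \<in> linked_avoiding r w"
    "covers r b w" "(b, t) \<in> linked_avoiding r w"
    using Uset_iff_linked[OF tree root] Dset_iff_linked by blast
  have "(a, b) \<in> linked_avoiding r w"
    using ab by (blast intro: linked_avoiding_trans linked_avoiding_commute)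
  moreover have "a \<noteq> b" using ab tree_antisym[OF tree, of a w] by (auto simp: covers_def)
  ultimately show False
    using no_link_between_neighbours[OF tree_acyclic[OF tree], of w a b] ab
    by (auto simp: cover_adj_def)
qed

lemma Field_eq_root_Uset_Dset: "Field r = insert w (Uset r w \<union> Dset r w)"
proof
  show "Field r \<subseteq> insert w (Uset r w \<union> Dset r w)"
  proof
    fix t assume t: "t \<in> Field r"
    with tree root have "\<exists>p. cover_path r w p t" unfolding tree_poset_def by blast
    then obtain p where p: "cover_path r w p t" ..
    show "t \<in> insert w (Uset r w \<union> Dset r w)"
    proof (cases "t = w")
      case False
      with p obtain a q where q: "p = w # a # q"
        by (cases p rule: remdups_adj.cases) (auto simp: cover_path_def)
      then have "(w, a) \<in> r \<or> (a, w) \<in> r"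
        using p by (auto simp: cover_path_def cover_adj_def covers_def)
      then have "(w, p ! 1) \<in> r \<or> (p ! 1, w) \<in> r" using q by simp
      then show ?thesis using p t False by (auto simp: Uset_def Dset_def)
    qed simp
  qed
qed (auto simp: Uset_def Dset_def root)

text \<open>Elements of \<open>Dset\<close> and \<open>Uset\<close> lie in different components of the cover graph without \<open>w\<close>, so a
saturated chain between them has to pass through \<open>w\<close>.\<close>

lemma Dset_below_Uset_iff:
  assumes "u \<in> Uset r w" "d \<in> Dset r w"
  shows "(d, u) \<in> r \<longleftrightarrow> (d, w) \<in> r \<and> (w, u) \<in> r" and "(u, d) \<notin> r"
proof -
  have "(d, u) \<notin> linked_avoiding r w"
    using assms Uset_linked[OF tree root, of u d] Uset_Dset_disjoint linked_avoiding_commute[of d u]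
    by blast
  then show "(d, u) \<in> r \<longleftrightarrow> (d, w) \<in> r \<and> (w, u) \<in> r"
    using rel_imp_linked_avoiding[OF tree_finite[OF tree] tree_po[OF tree]] tree_trans[OF tree]
    by blast
  have "(u, d) \<notin> linked_avoiding r w"
    using assms Uset_linked[OF tree root, of u d] Uset_Dset_disjoint by blast
  moreover have "(u, w) \<notin> r"
    using smaller_in_Dset assms(1) Uset_Dset_disjoint by (auto simp: Uset_def)
  ultimately show "(u, d) \<notin> r"
    using rel_imp_linked_avoiding[OF tree_finite[OF tree] tree_po[OF tree]] by blast
qed

lemma Uset_plus_iff: "t \<in> Field r \<Longrightarrow> (w, t) \<in> r \<longleftrightarrow> t = w \<or> t \<in> Uset_plus r w"
  using greater_in_Uset[OF tree root] tree_refl[OF tree root] by (auto simp: Uset_plus_def)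

lemma Dset_minus_iff: "t \<in> Field r \<Longrightarrow> (t, w) \<in> r \<longleftrightarrow> t = w \<or> t \<in> Dset_minus r w"
  using smaller_in_Dset tree_refl[OF tree root] by (auto simp: Dset_minus_def)

lemma Field_Restr_subset: "S \<subseteq> Field r \<Longrightarrow> Field (Restr r S) = S"
  using tree_refl[OF tree] by (fastforce simp: Field_def)

lemma realizer_Restr:
  assumes "realizer (Restr r S) Ls" "S \<subseteq> Field r" "s \<in> S" "t \<in> S"
  shows "(s, t) \<in> r \<longleftrightarrow> (\<forall>L \<in> set Ls. (s, t) \<in> word_order L)"
  using assms(1,3,4) unfolding realizer_def Field_Restr_subset[OF assms(2)] by blast

context
  fixes W :: "'a tree_words"
  assumes adm: "admissible r w W"
begin

lemma admissible_sets:
  "set (wUm W) = Uset_minus r w" "set (wUp W) = Uset_plus r w"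
  "set (wU1 W) = Uset r w" "set (wU2 W) = Uset r w"
  "set (wDm W) = Dset_minus r w" "set (wDp W) = Dset_plus r w"
  "set (wD1 W) = Dset r w" "set (wD2 W) = Dset r w"
proof -
  have *: "Uset r w \<subseteq> Field r" "Dset r w \<subseteq> Field r" "Uset_minus r w \<subseteq> Field r"
    "Uset_plus r w \<subseteq> Field r" "Dset_minus r w \<subseteq> Field r" "Dset_plus r w \<subseteq> Field r"
    by (auto simp: Uset_def Dset_def Uset_minus_def Uset_plus_def Dset_minus_def Dset_plus_def)
  show
    "set (wUm W) = Uset_minus r w" "set (wUp W) = Uset_plus r w"
    "set (wU1 W) = Uset r w" "set (wU2 W) = Uset r w"
    "set (wDm W) = Dset_minus r w" "set (wDp W) = Dset_plus r w"
    "set (wD1 W) = Dset r w" "set (wD2 W) = Dset r w"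
    using adm by (auto simp: admissible_def linear_extension_def *[THEN Field_Restr_subset])
qed

lemma admissible_distinct:
  "distinct (wUm W)" "distinct (wUp W)" "distinct (wU1 W)" "distinct (wU2 W)"
  "distinct (wDm W)" "distinct (wDp W)" "distinct (wD1 W)" "distinct (wD2 W)"
  using adm by (auto simp: admissible_def linear_extension_def)

lemma root_notin: "w \<notin> Uset r w" "w \<notin> Dset r w"
  by (auto simp: Uset_def Dset_def)

lemma plus_minus_partition:
  "Uset r w = Uset_plus r w \<union> Uset_minus r w" "Uset_plus r w \<inter> Uset_minus r w = {}"
  "Dset r w = Dset_plus r w \<union> Dset_minus r w" "Dset_plus r w \<inter> Dset_minus r w = {}"
  by (auto simp: Uset_minus_def Uset_plus_def Dset_minus_def Dset_plus_def)

lemma set_root_Up: "set (w # wUp W) = {t \<in> Field r. (w, t) \<in> r}"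
proof -
  have "Uset_plus r w \<subseteq> Field r" by (auto simp: Uset_plus_def Uset_def)
  then show ?thesis using root Uset_plus_iff by (auto simp: admissible_sets)
qed

lemma set_Dm_root: "set (wDm W @ [w]) = {t \<in> Field r. (t, w) \<in> r}"
proof -
  have "Dset_minus r w \<subseteq> Field r" by (auto simp: Dset_minus_def Dset_def)
  then show ?thesis using root Dset_minus_iff by (auto simp: admissible_sets)
qed

lemma set_Um_D1: "set (wUm W @ wD1 W) = {t \<in> Field r. (w, t) \<notin> r}"
proof -
  have "set (wUm W @ wD1 W) = Field r - insert w (Uset_plus r w)"
    using root_notin Uset_Dset_disjoint
    by (auto simp: admissible_sets Uset_minus_def Field_eq_root_Uset_Dset Uset_plus_def)
  also have "insert w (Uset_plus r w) = {t \<in> Field r. (w, t) \<in> r}"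
    using set_root_Up by (simp add: admissible_sets)
  finally show ?thesis by auto
qed

lemma set_U1_Dp: "set (wU1 W @ wDp W) = {t \<in> Field r. (t, w) \<notin> r}"
proof -
  have "set (wU1 W @ wDp W) = Field r - insert w (Dset_minus r w)"
    using root_notin Uset_Dset_disjoint
    by (auto simp: admissible_sets Dset_plus_def Field_eq_root_Uset_Dset Dset_minus_def)
  also have "insert w (Dset_minus r w) = {t \<in> Field r. (t, w) \<in> r}"
    using set_Dm_root by (simp add: admissible_sets)
  finally show ?thesis by auto
qed

lemma set_D2_root_U2: "set (wD2 W @ w # wU2 W) = Field r"
  by (auto simp: admissible_sets Field_eq_root_Uset_Dset)

lemma distinct_pieces:
  "distinct (wUm W @ wD1 W)" "distinct (w # wUp W)" "distinct (wDm W @ [w])"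
  "distinct (wU1 W @ wDp W)" "distinct (wD2 W @ w # wU2 W)"
  using admissible_distinct admissible_sets plus_minus_partition root_notin Uset_Dset_disjoint
  by auto

lemma Uset_root_notin: "x \<in> Uset r w \<union> {w} \<Longrightarrow> x \<notin> Dset r w \<and> x \<notin> Dset_minus r w \<and> x \<notin> Dset_plus r w"
  using root_notin Uset_Dset_disjoint by (auto simp: Dset_minus_def Dset_plus_def)

lemma Dset_root_notin: "x \<in> Dset r w \<union> {w} \<Longrightarrow> x \<notin> Uset r w \<and> x \<notin> Uset_minus r w \<and> x \<notin> Uset_plus r w"
  using root_notin Uset_Dset_disjoint by (auto simp: Uset_minus_def Uset_plus_def)

text \<open>On \<open>U\<close> with the root the three words are those of the realizer for \<open>U\<close>, and similarly for \<open>D\<close>, as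
the other letters can be dropped.  For \<open>s\<close> in \<open>D\<close> and \<open>t\<close> in \<open>U\<close> the third word always puts \<open>s\<close>
first, the first word does so only if \<open>t\<close> lies above the root, and the second one only if \<open>s\<close> lies
below it.\<close>

lemma rel_iff_in_three_words:
  assumes "s \<in> Field r" "t \<in> Field r"
  shows "(s, t) \<in> r \<longleftrightarrow>
    (s, t) \<in> word_order (wUm W @ wD1 W @ w # wUp W) \<and>
    (s, t) \<in> word_order (wDm W @ w # wU1 W @ wDp W) \<and>
    (s, t) \<in> word_order (wD2 W @ w # wU2 W)" (is "_ \<longleftrightarrow> ?P \<and> ?Q \<and> ?R")
proof -
  have US: "Uset r w \<union> {w} \<subseteq> Field r" and DS: "Dset r w \<union> {w} \<subseteq> Field r"
    using Field_eq_root_Uset_Dset by auto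
  have adm_realizers:
    "realizer (Restr r (Uset r w \<union> {w})) [wUm W @ [w] @ wUp W, [w] @ wU1 W, [w] @ wU2 W]"
    "realizer (Restr r (Dset r w \<union> {w})) [wDm W @ [w] @ wDp W, wD1 W @ [w], wD2 W @ [w]]"
    using adm unfolding admissible_def by blast+
  consider "s \<in> Uset r w \<union> {w}" "t \<in> Uset r w \<union> {w}"
    | "s \<in> Dset r w \<union> {w}" "t \<in> Dset r w \<union> {w}"
    | "s \<in> Dset r w" "t \<in> Uset r w" | "s \<in> Uset r w" "t \<in> Dset r w"
    using assms Field_eq_root_Uset_Dset by blast
  then show ?thesis
  proof cases
    case 1
    have notin: "{s, t} \<inter> set (wD1 W) = {}" "{s, t} \<inter> set (wD2 W) = {}"
      "{s, t} \<inter> set (wDm W) = {}" "{s, t} \<inter> set (wDp W) = {}"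
      using Uset_root_notin[OF 1(1)] Uset_root_notin[OF 1(2)] by (simp_all add: admissible_sets)
    have "(s, t) \<in> r \<longleftrightarrow> (s, t) \<in> word_order (wUm W @ w # wUp W) \<and>
        (s, t) \<in> word_order (w # wU1 W) \<and> (s, t) \<in> word_order (w # wU2 W)"
      using realizer_Restr[OF adm_realizers(1) US 1] by simp
    moreover have "?P \<longleftrightarrow> (s, t) \<in> word_order (wUm W @ w # wUp W)"
      by (rule word_order_drop_middle[OF notin(1)])
    moreover have "?Q \<longleftrightarrow> (s, t) \<in> word_order (w # wU1 W)"
      using word_order_drop_middle[OF notin(3), of "[]"]
        word_order_drop_middle[OF notin(4), of "w # wU1 W" "[]"] by simp
    moreover have "?R \<longleftrightarrow> (s, t) \<in> word_order (w # wU2 W)"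
      using word_order_drop_middle[OF notin(2), of "[]"] by simp
    ultimately show ?thesis by blast
  next
    case 2
    have notin: "{s, t} \<inter> set (wU1 W) = {}" "{s, t} \<inter> set (wU2 W) = {}"
      "{s, t} \<inter> set (wUm W) = {}" "{s, t} \<inter> set (wUp W) = {}"
      using Dset_root_notin[OF 2(1)] Dset_root_notin[OF 2(2)] by (simp_all add: admissible_sets)
    have "(s, t) \<in> r \<longleftrightarrow> (s, t) \<in> word_order (wDm W @ w # wDp W) \<and>
        (s, t) \<in> word_order (wD1 W @ [w]) \<and> (s, t) \<in> word_order (wD2 W @ [w])"
      using realizer_Restr[OF adm_realizers(2) DS 2] by simp
    moreover have "?P \<longleftrightarrow> (s, t) \<in> word_order (wD1 W @ [w])"
      using word_order_drop_middle[OF notin(3), of "[]"]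
        word_order_drop_middle[OF notin(4), of "wD1 W @ [w]" "[]"] by simp
    moreover have "?Q \<longleftrightarrow> (s, t) \<in> word_order (wDm W @ w # wDp W)"
      using word_order_drop_middle[OF notin(1), of "wDm W @ [w]" "wDp W"] by simp
    moreover have "?R \<longleftrightarrow> (s, t) \<in> word_order (wD2 W @ [w])"
      using word_order_drop_middle[OF notin(2), of "wD2 W @ [w]" "[]"] by simp
    ultimately show ?thesis by blast
  next
    case 3
    have s: "s \<in> Dset_minus r w \<or> s \<in> Dset_plus r w" "s \<notin> Uset r w" "s \<notin> Uset_minus r w" "s \<noteq> w"
      using 3 root_notin Dset_root_notin[of s] by (auto simp: Dset_plus_def)
    have t: "t \<in> Uset_plus r w \<or> t \<in> Uset_minus r w" "t \<notin> Dset r w" "t \<notin> Dset_plus r w" "t \<noteq> w"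
      using 3 root_notin Uset_root_notin[of t] by (auto simp: Uset_minus_def)
    have "?P \<longleftrightarrow> t \<in> Uset_plus r w"
    proof (cases "t \<in> Uset_plus r w")
      case True
      then show ?thesis
        using word_order_appendI[of s "wUm W @ wD1 W" t "w # wUp W"] 3 by (simp add: admissible_sets)
    next
      case False
      then show ?thesis
        using word_order_append_notin[of s "wUm W" t "wD1 W @ w # wUp W"] s t by (simp add: admissible_sets)
    qed
    moreover have "?Q \<longleftrightarrow> s \<in> Dset_minus r w"
    proof (cases "s \<in> Dset_minus r w")
      case True
      then show ?thesis
        using word_order_appendI[of s "wDm W @ [w]" t "wU1 W @ wDp W"] 3 by (simp add: admissible_sets)
    next
      case False
      then show ?thesis
        using word_order_append_notin[of s "wDm W @ w # wU1 W" t "wDp W"] s t by (simp add: admissible_sets)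
    qed
    moreover have "?R"
      using word_order_appendI[of s "wD2 W" t "w # wU2 W"] 3 by (simp add: admissible_sets)
    moreover have "(s, t) \<in> r \<longleftrightarrow> (s, w) \<in> r \<and> (w, t) \<in> r"
      using Dset_below_Uset_iff 3 by blast
    moreover have "(s, w) \<in> r \<longleftrightarrow> s \<in> Dset_minus r w" "(w, t) \<in> r \<longleftrightarrow> t \<in> Uset_plus r w"
      using 3 by (auto simp: Dset_minus_def Uset_plus_def)
    ultimately show ?thesis by blast
  next
    case 4
    then have "(s, t) \<notin> r" using Dset_below_Uset_iff by blast
    moreover have "s \<notin> Dset r w" "t \<notin> Uset r w" "t \<noteq> w"
      using 4 root_notin Uset_Dset_disjoint by auto
    then have "\<not> ?R"
      using word_order_append_notin[of s "wD2 W" t "w # wU2 W"] by (simp add: admissible_sets)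
    ultimately show ?thesis by blast
  qed
qed

end
end

section \<open>From layouts to realizers of a grafting\<close>

text \<open>The way in which a word reads the tree at a vertex: in two pieces with the root in the second one,
in two pieces with the root in the first one, or in one piece.\<close>

datatype shape = Late | Early | Whole

lemma all_shapes_iff: "(\<forall>s. P s) \<longleftrightarrow> P Late \<and> P Early \<and> P Whole"
  by (metis shape.exhaust)

text \<open>A token stands for one contiguous piece of a tree, in the order \<open>U\<^sup>- D\<^sub>1\<close>, \<open>v U\<^sup>+\<close>, \<open>D\<^sup>- v\<close>, \<open>U\<^sub>1 D\<^sup>+\<close>,
\<open>D\<^sub>2 v U\<^sub>2\<close>.\<close>

datatype token = LateFst vert | LateSnd vert | EarlyFst vert | EarlySnd vert | Single vert

fun tokens :: "shape \<Rightarrow> vert \<Rightarrow> token list" where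
  "tokens Late v = [LateFst v, LateSnd v]"
| "tokens Early v = [EarlyFst v, EarlySnd v]"
| "tokens Whole v = [Single v]"

fun spell :: "(vert \<Rightarrow> 't) \<Rightarrow> (vert \<Rightarrow> 't tree_words) \<Rightarrow> token \<Rightarrow> (vert \<times> 't) list" where
  "spell \<rho> W (LateFst v) = I_minus W v"
| "spell \<rho> W (LateSnd v) = V_plus \<rho> W v"
| "spell \<rho> W (EarlyFst v) = V_minus \<rho> W v"
| "spell \<rho> W (EarlySnd v) = I_plus W v"
| "spell \<rho> W (Single v) = V_bullet \<rho> W v"

fun token_key :: "(vert \<Rightarrow> 'o) \<Rightarrow> (vert \<Rightarrow> 'o) \<Rightarrow> token \<Rightarrow> 'o" where
  "token_key lo hi (LateFst v) = lo v"
| "token_key lo hi (LateSnd v) = hi v"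
| "token_key lo hi (EarlyFst v) = lo v"
| "token_key lo hi (EarlySnd v) = hi v"
| "token_key lo hi (Single v) = lo v"

text \<open>One word over the grafting, given by a list \<open>ts\<close> of tokens that is sorted by a key.  The span of \<open>v\<close>
reaches from \<open>lo v\<close>, the key of its first token, to \<open>hi v\<close>, the key of its last one.\<close>

locale layout =
  fixes V :: "vert set" and T :: "vert \<Rightarrow> 't rel" and \<rho> :: "vert \<Rightarrow> 't"
    and W :: "vert \<Rightarrow> 't tree_words"
    and shape :: "vert \<Rightarrow> shape" and lo hi :: "vert \<Rightarrow> 'o::linorder" and ts :: "token list"
  assumes rooted: "v \<in> V \<Longrightarrow> rooted_tree_poset (T v) (\<rho> v)"
    and adm: "v \<in> V \<Longrightarrow> admissible (T v) (\<rho> v) (W v)"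
    and lo_hi: "v \<in> V \<Longrightarrow> if shape v = Whole then lo v = hi v else lo v < hi v"
    and sorted: "sorted_wrt (\<lambda>s t. token_key lo hi s < token_key lo hi t) ts"
    and set_ts: "set ts = (\<Union>v \<in> V. set (tokens (shape v) v))"
begin

text \<open>The key of the token that contains the root, and the key of the token that contains a given
element.\<close>

definition root_key :: "vert \<Rightarrow> 'o" where
  "root_key v = (if shape v = Late then hi v else lo v)"

definition key :: "vert \<times> 't \<Rightarrow> 'o" where
  "key = (\<lambda>(v, t). case shape v of
     Late \<Rightarrow> if (\<rho> v, t) \<in> T v then hi v else lo v
   | Early \<Rightarrow> if (t, \<rho> v) \<in> T v then lo v else hi v
   | Whole \<Rightarrow> lo v)"

definition line :: "(vert \<times> 't) list" where
  "line = concat (map (spell \<rho> W) ts)"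

lemma tree: "v \<in> V \<Longrightarrow> tree_poset (T v)" and root: "v \<in> V \<Longrightarrow> \<rho> v \<in> Field (T v)"
  using rooted by (auto simp: rooted_tree_poset_def)

lemma spell_set:
  assumes "v \<in> V"
  shows "set (spell \<rho> W (LateFst v)) = {v} \<times> {t \<in> Field (T v). (\<rho> v, t) \<notin> T v}"
    and "set (spell \<rho> W (LateSnd v)) = {v} \<times> {t \<in> Field (T v). (\<rho> v, t) \<in> T v}"
    and "set (spell \<rho> W (EarlyFst v)) = {v} \<times> {t \<in> Field (T v). (t, \<rho> v) \<in> T v}"
    and "set (spell \<rho> W (EarlySnd v)) = {v} \<times> {t \<in> Field (T v). (t, \<rho> v) \<notin> T v}"
    and "set (spell \<rho> W (Single v)) = {v} \<times> Field (T v)"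
proof -
  note pieces = set_Um_D1[OF tree root adm] set_root_Up[OF tree root adm]
    set_Dm_root[OF tree root adm] set_U1_Dp[OF tree root adm] set_D2_root_U2[OF tree root adm]
  note defs = I_minus_def I_plus_def V_plus_def V_minus_def V_bullet_def V_root_def
    U_minus_def U_plus_def U_1_def U_2_def D_minus_def D_plus_def D_1_def D_2_def
  have img: "map (Pair v) xs = ys \<Longrightarrow> set xs = S \<Longrightarrow> set ys = {v} \<times> S" for xs :: "'t list" and ys S
    by auto
  show "set (spell \<rho> W (LateFst v)) = {v} \<times> {t \<in> Field (T v). (\<rho> v, t) \<notin> T v}"
    by (rule img[OF _ pieces(1)[OF assms assms assms]]) (simp add: defs)
  show "set (spell \<rho> W (LateSnd v)) = {v} \<times> {t \<in> Field (T v). (\<rho> v, t) \<in> T v}"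
    by (rule img[OF _ pieces(2)[OF assms assms assms]]) (simp add: defs)
  show "set (spell \<rho> W (EarlyFst v)) = {v} \<times> {t \<in> Field (T v). (t, \<rho> v) \<in> T v}"
    by (rule img[OF _ pieces(3)[OF assms assms assms]]) (simp add: defs)
  show "set (spell \<rho> W (EarlySnd v)) = {v} \<times> {t \<in> Field (T v). (t, \<rho> v) \<notin> T v}"
    by (rule img[OF _ pieces(4)[OF assms assms assms]]) (simp add: defs)
  show "set (spell \<rho> W (Single v)) = {v} \<times> Field (T v)"
    by (rule img[OF _ pieces(5)[OF assms assms assms]]) (simp add: defs)
qed

lemma spell_distinct:
  assumes "v \<in> V" "tok \<in> set (tokens s v)"
  shows "distinct (spell \<rho> W tok)"
  using assms(2) distinct_pieces[OF tree root adm, OF assms(1) assms(1) assms(1)]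
  by (cases s) (auto simp: I_minus_def I_plus_def V_plus_def V_minus_def V_bullet_def V_root_def
    U_minus_def U_plus_def U_1_def U_2_def D_minus_def D_plus_def D_1_def D_2_def
    distinct_map inj_on_def)

lemma spell_key:
  assumes "v \<in> V" "tok \<in> set (tokens (shape v) v)" "e \<in> set (spell \<rho> W tok)"
  shows "fst e = v" "snd e \<in> Field (T v)" "key e = token_key lo hi tok"
proof -
  have "fst e = v \<and> snd e \<in> Field (T v) \<and> key e = token_key lo hi tok"
    using assms by (cases "shape v") (auto simp: key_def spell_set simp del: spell.simps)
  then show "fst e = v" "snd e \<in> Field (T v)" "key e = token_key lo hi tok" by auto
qed

lemma spell_cover:
  assumes "v \<in> V" "t \<in> Field (T v)"
  shows "\<exists>tok \<in> set (tokens (shape v) v). (v, t) \<in> set (spell \<rho> W tok)"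
  using assms by (cases "shape v") (auto simp: spell_set simp del: spell.simps)

lemma token_key_inj:
  assumes "s \<in> set ts" "t \<in> set ts" "token_key lo hi s = token_key lo hi t"
  shows "s = t"
proof -
  have "sorted_wrt (<) (map (token_key lo hi) ts)" using sorted by (simp add: sorted_wrt_map)
  then have "distinct (map (token_key lo hi) ts)" by (simp add: strict_sorted_iff)
  then show ?thesis using assms by (auto simp: distinct_map dest: inj_onD)
qed

lemma set_line: "set line = Sigma V (\<lambda>v. Field (T v))"
proof (intro set_eqI iffI)
  fix e assume "e \<in> set line"
  then obtain v tok where "v \<in> V" "tok \<in> set (tokens (shape v) v)" "e \<in> set (spell \<rho> W tok)"
    by (auto simp: line_def set_ts)
  then show "e \<in> Sigma V (\<lambda>v. Field (T v))"
    using spell_key by (cases e) fastforce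
next
  fix e assume "e \<in> Sigma V (\<lambda>v. Field (T v))"
  then obtain v t where e: "e = (v, t)" "v \<in> V" "t \<in> Field (T v)" by blast
  from spell_cover[OF e(2,3)] show "e \<in> set line"
    using e by (auto simp: line_def set_ts)
qed

lemma distinct_line: "distinct line"
  unfolding line_def
proof (rule distinct_concat_map)
  have "sorted_wrt (<) (map (token_key lo hi) ts)" using sorted by (simp add: sorted_wrt_map)
  then show "distinct ts" by (auto simp: strict_sorted_iff distinct_map)
  show "distinct (spell \<rho> W t)" if "t \<in> set ts" for t
    using that spell_distinct by (auto simp: set_ts)
  show "s = t" if "s \<in> set ts" "t \<in> set ts" "e \<in> set (spell \<rho> W s)" "e \<in> set (spell \<rho> W t)" for s t e
  proof (rule token_key_inj[OF that(1,2)])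
    show "token_key lo hi s = token_key lo hi t"
      using that spell_key(3) unfolding set_ts by (metis (no_types, lifting) UN_E)
  qed
qed

lemma key_bounds:
  assumes "v \<in> V"
  shows "lo v \<le> key (v, t)" "key (v, t) \<le> hi v"
  using lo_hi[OF assms] by (auto simp: key_def split: shape.splits if_splits)

text \<open>Elements below the root never come in a later piece than the root, and only an \<open>Early\<close> vertex has
a piece after the one with the root.  The dual statements hold for elements above the root.\<close>

lemma key_root:
  assumes "v \<in> V"
  shows "(t, \<rho> v) \<in> T v \<Longrightarrow> key (v, t) \<le> root_key v"
    and "(\<rho> v, t) \<in> T v \<Longrightarrow> root_key v \<le> key (v, t)"
    and "shape v \<noteq> Early \<Longrightarrow> key (v, t) \<le> root_key v"
    and "shape v \<noteq> Late \<Longrightarrow> root_key v \<le> key (v, t)"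
  using lo_hi[OF assms] by (auto simp: key_def root_key_def split: shape.splits if_splits)

lemma line_order:
  assumes "a \<in> V" "c \<in> V" "b \<in> Field (T a)" "d \<in> Field (T c)"
  shows "((a, b), (c, d)) \<in> word_order line \<longleftrightarrow>
    key (a, b) < key (c, d) \<or>
    (\<exists>tok \<in> set (tokens (shape a) a). ((a, b), (c, d)) \<in> word_order (spell \<rho> W tok))"
proof -
  have "(\<exists>s \<in> set ts. \<exists>t \<in> set ts. token_key lo hi s < token_key lo hi t \<and>
      (a, b) \<in> set (spell \<rho> W s) \<and> (c, d) \<in> set (spell \<rho> W t)) \<longleftrightarrow> key (a, b) < key (c, d)"
    (is "?L \<longleftrightarrow> ?R")
  proof
    assume ?L
    then show ?R unfolding set_ts using spell_key(3) by (metis (no_types, lifting) UN_E)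
  next
    assume ?R
    obtain s where s: "s \<in> set (tokens (shape a) a)" "(a, b) \<in> set (spell \<rho> W s)"
      using spell_cover assms by blast
    obtain t where t: "t \<in> set (tokens (shape c) c)" "(c, d) \<in> set (spell \<rho> W t)"
      using spell_cover assms by blast
    have "token_key lo hi s < token_key lo hi t"
      using \<open>?R\<close> spell_key(3)[OF assms(1) s] spell_key(3)[OF assms(2) t] by simp
    moreover have "s \<in> set ts" "t \<in> set ts" using s t assms by (auto simp: set_ts)
    ultimately show ?L using s t by blast
  qed
  moreover have "(\<exists>t \<in> set ts. ((a, b), (c, d)) \<in> word_order (spell \<rho> W t)) \<longleftrightarrow>
      (\<exists>tok \<in> set (tokens (shape a) a). ((a, b), (c, d)) \<in> word_order (spell \<rho> W tok))"
    (is "?L \<longleftrightarrow> ?R")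
  proof
    assume ?L
    then obtain v tok where tok: "v \<in> V" "tok \<in> set (tokens (shape v) v)"
      "((a, b), (c, d)) \<in> word_order (spell \<rho> W tok)" by (auto simp: set_ts)
    then have "(a, b) \<in> set (spell \<rho> W tok)" using word_order_subset by blast
    then have "v = a" using spell_key(1)[OF tok(1,2)] by fastforce
    then show ?R using tok by blast
  next
    assume ?R
    then show ?L using assms(1) by (auto simp: set_ts)
  qed
  ultimately show ?thesis
    unfolding line_def word_order_concat_sorted[OF sorted] by blast
qed

text \<open>No token meets two trees, so between different trees only the keys count.\<close>

lemma line_order_distinct_roots:
  assumes "a \<in> V" "c \<in> V" "b \<in> Field (T a)" "d \<in> Field (T c)" "a \<noteq> c"
  shows "((a, b), (c, d)) \<in> word_order line \<longleftrightarrow> key (a, b) < key (c, d)"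
proof -
  have "((a, b), (c, d)) \<notin> word_order (spell \<rho> W tok)" if "tok \<in> set (tokens (shape a) a)" for tok
    using spell_key(1)[OF assms(1) that, of "(c, d)"] assms(5) word_order_subset by fastforce
  then show ?thesis using line_order[OF assms(1-4)] by blast
qed

fun tree_word :: "shape \<Rightarrow> vert \<Rightarrow> 't list" where
  "tree_word Late v = wUm (W v) @ wD1 (W v) @ \<rho> v # wUp (W v)"
| "tree_word Early v = wDm (W v) @ \<rho> v # wU1 (W v) @ wDp (W v)"
| "tree_word Whole v = wD2 (W v) @ \<rho> v # wU2 (W v)"

lemma line_order_same_root:
  assumes "v \<in> V" "s \<in> Field (T v)" "t \<in> Field (T v)"
  shows "((v, s), (v, t)) \<in> word_order line \<longleftrightarrow> (s, t) \<in> word_order (tree_word (shape v) v)"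
proof -
  note defs = I_minus_def I_plus_def V_plus_def V_minus_def V_bullet_def V_root_def
    U_minus_def U_plus_def U_1_def U_2_def D_minus_def D_plus_def D_1_def D_2_def
  have spelled: "concat (map (spell \<rho> W) (tokens (shape v) v)) = map (Pair v) (tree_word (shape v) v)"
    by (cases "shape v") (simp_all add: defs)
  have srt: "sorted_wrt (\<lambda>s t. token_key lo hi s < token_key lo hi t) (tokens (shape v) v)"
    using lo_hi[OF assms(1)] by (cases "shape v") simp_all
  have "(s, t) \<in> word_order (tree_word (shape v) v) \<longleftrightarrow>
      ((v, s), (v, t)) \<in> word_order (concat (map (spell \<rho> W) (tokens (shape v) v)))"
    unfolding spelled word_order_map_Pair ..
  also have "\<dots> \<longleftrightarrow>
      (\<exists>x \<in> set (tokens (shape v) v). ((v, s), (v, t)) \<in> word_order (spell \<rho> W x)) \<or>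
      (\<exists>x \<in> set (tokens (shape v) v). \<exists>y \<in> set (tokens (shape v) v).
         token_key lo hi x < token_key lo hi y \<and>
         (v, s) \<in> set (spell \<rho> W x) \<and> (v, t) \<in> set (spell \<rho> W y))"
    by (rule word_order_concat_sorted[OF srt])
  also have "(\<exists>x \<in> set (tokens (shape v) v). \<exists>y \<in> set (tokens (shape v) v).
         token_key lo hi x < token_key lo hi y \<and>
         (v, s) \<in> set (spell \<rho> W x) \<and> (v, t) \<in> set (spell \<rho> W y)) \<longleftrightarrow>
      key (v, s) < key (v, t)"
    using spell_key(3)[OF assms(1)] spell_cover[OF assms(1,2)] spell_cover[OF assms(1,3)] by metis
  finally show ?thesis using line_order[OF assms(1,1,2,3)] by blast
qed

end

lemma realizer_if_rel_iff:
  assumes "\<And>L. L \<in> set Ls \<Longrightarrow> distinct L \<and> set L = Field r"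
    and "\<And>u v. u \<in> Field r \<Longrightarrow> v \<in> Field r \<Longrightarrow> (u, v) \<in> r \<longleftrightarrow> (\<forall>L \<in> set Ls. (u, v) \<in> word_order L)"
  shows "realizer r Ls"
proof -
  have "r \<subseteq> word_order L" if "L \<in> set Ls" for L
  proof (rule subrelI)
    fix u v assume "(u, v) \<in> r"
    moreover have "u \<in> Field r" "v \<in> Field r" using \<open>(u, v) \<in> r\<close> by (auto simp: Field_def)
    ultimately show "(u, v) \<in> word_order L" using assms(2) that by blast
  qed
  then show ?thesis using assms by (auto simp: realizer_def linear_extension_def)
qed

lemma Field_graft:
  assumes "\<And>v t. v \<in> Field Q \<Longrightarrow> t \<in> Field (T v) \<Longrightarrow> (t, t) \<in> T v"
  shows "Field (graft Q T \<rho>) = Sigma (Field Q) (\<lambda>v. Field (T v))"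
proof
  show "Field (graft Q T \<rho>) \<subseteq> Sigma (Field Q) (\<lambda>v. Field (T v))"
    by (force simp: graft_def Field_def)
  show "Sigma (Field Q) (\<lambda>v. Field (T v)) \<subseteq> Field (graft Q T \<rho>)"
  proof
    fix e assume "e \<in> Sigma (Field Q) (\<lambda>v. Field (T v))"
    then obtain v t where "e = (v, t)" "v \<in> Field Q" "t \<in> Field (T v)" by blast
    then have "(e, e) \<in> graft Q T \<rho>" using assms by (simp add: graft_def)
    then show "e \<in> Field (graft Q T \<rho>)" by (rule FieldI1)
  qed
qed

text \<open>The assumption \<open>third\<close> says that for a pair \<open>a < c\<close> some word is neither the one that moves elements
of \<open>T\<^sub>a\<close> to the right of their root nor the one that moves elements of \<open>T\<^sub>c\<close> to the left of theirs.
This word keeps every element of \<open>T\<^sub>a\<close> before every element of \<open>T\<^sub>c\<close>.\<close>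

theorem layouts_realize_graft:
  fixes lo hi :: "'w \<Rightarrow> vert \<Rightarrow> 'o::linorder"
  assumes lay: "\<And>w. w \<in> set ws \<Longrightarrow> layout (Field Q) T \<rho> W (shp w) (lo w) (hi w) (ts w)"
    and rooted: "\<And>v. v \<in> Field Q \<Longrightarrow> rooted_tree_poset (T v) (\<rho> v)"
    and adm: "\<And>v. v \<in> Field Q \<Longrightarrow> admissible (T v) (\<rho> v) (W v)"
    and refl: "\<And>v. v \<in> Field Q \<Longrightarrow> (v, v) \<in> Q"
    and all_shapes: "\<And>v s. v \<in> Field Q \<Longrightarrow> \<exists>w \<in> set ws. shp w v = s"
    and third: "\<And>a c. (a, c) \<in> Q \<Longrightarrow> a \<noteq> c \<Longrightarrow> \<exists>w \<in> set ws. shp w a \<noteq> Early \<and> shp w c \<noteq> Late"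
    and less_root: "\<And>a c w. (a, c) \<in> Q \<Longrightarrow> a \<noteq> c \<Longrightarrow> w \<in> set ws \<Longrightarrow>
       (if shp w a = Late then hi w a else lo w a) < (if shp w c = Late then hi w c else lo w c)"
    and less_hi: "\<And>a c w. (a, c) \<in> Q \<Longrightarrow> a \<noteq> c \<Longrightarrow> w \<in> set ws \<Longrightarrow> shp w a = Early \<Longrightarrow> hi w c < hi w a"
    and less_lo: "\<And>a c w. (a, c) \<in> Q \<Longrightarrow> a \<noteq> c \<Longrightarrow> w \<in> set ws \<Longrightarrow> shp w c = Late \<Longrightarrow> lo w c < lo w a"
    and parallel: "\<And>a c. a \<in> Field Q \<Longrightarrow> c \<in> Field Q \<Longrightarrow> (a, c) \<notin> Q \<Longrightarrow> (c, a) \<notin> Q \<Longrightarrow>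
       \<exists>w \<in> set ws. hi w a < lo w c"
  shows "realizer (graft Q T \<rho>) (map (\<lambda>w. concat (map (spell \<rho> W) (ts w))) ws)"
proof -
  have trefl: "(t, t) \<in> T v" if "v \<in> Field Q" "t \<in> Field (T v)" for v t
    using tree_refl[of "T v" t] rooted[of v] that by (simp add: rooted_tree_poset_def)
  have F: "Field (graft Q T \<rho>) = Sigma (Field Q) (\<lambda>v. Field (T v))"
    by (rule Field_graft) (rule trefl)
  define L where "L w = concat (map (spell \<rho> W) (ts w))" for w
  define key where "key w = layout.key T \<rho> (shp w) (lo w) (hi w)" for w
  define rk where "rk w v = (if shp w v = Late then hi w v else lo w v)" for w v
  have L: "L w = layout.line \<rho> W (ts w)" if "w \<in> set ws" for w
    unfolding L_def layout.line_def[OF lay[OF that]] ..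
  have rk: "rk w = layout.root_key (shp w) (lo w) (hi w)" if "w \<in> set ws" for w
    by (rule ext) (simp add: rk_def layout.root_key_def[OF lay[OF that]])
  have main: "((a, b), (c, d)) \<in> graft Q T \<rho> \<longleftrightarrow> (\<forall>w \<in> set ws. ((a, b), (c, d)) \<in> word_order (L w))"
    if a: "a \<in> Field Q" and c: "c \<in> Field Q" and b: "b \<in> Field (T a)" and d: "d \<in> Field (T c)"
    for a b c d
  proof (cases "a = c")
    case True
    have shapes: "(b, d) \<in> T a \<longleftrightarrow> (\<forall>s. (b, d) \<in> word_order (layout.tree_word \<rho> W s a))"
    proof -
      obtain w where w: "w \<in> set ws" using all_shapes a by blast
      have "(b, d) \<in> T a \<longleftrightarrow>
        (b, d) \<in> word_order (layout.tree_word \<rho> W Late a) \<and>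
        (b, d) \<in> word_order (layout.tree_word \<rho> W Early a) \<and>
        (b, d) \<in> word_order (layout.tree_word \<rho> W Whole a)"
        unfolding layout.tree_word.simps[OF lay[OF w]]
        using rel_iff_in_three_words[of "T a" "\<rho> a" "W a" b d] rooted[OF a] adm[OF a] b d True
        by (simp add: rooted_tree_poset_def)
      then show ?thesis unfolding all_shapes_iff .
    qed
    have "((a, b), (c, d)) \<in> graft Q T \<rho> \<longleftrightarrow> (b, d) \<in> T a"
      using True a by (simp add: graft_def)
    also have "\<dots> \<longleftrightarrow> (\<forall>w \<in> set ws. (b, d) \<in> word_order (layout.tree_word \<rho> W (shp w a) a))"
      unfolding shapes
    proof (intro iffI allI ballI)
      fix s assume *: "\<forall>w \<in> set ws. (b, d) \<in> word_order (layout.tree_word \<rho> W (shp w a) a)"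
      obtain w where "w \<in> set ws" "shp w a = s" using all_shapes[OF a] by blast
      with * show "(b, d) \<in> word_order (layout.tree_word \<rho> W s a)" by blast
    qed blast
    also have "\<dots> \<longleftrightarrow> (\<forall>w \<in> set ws. ((a, b), (c, d)) \<in> word_order (L w))"
      using True b d a L layout.line_order_same_root[OF lay] by simp
    finally show ?thesis .
  next
    case False
    have ord: "((a, b), (c, d)) \<in> word_order (L w) \<longleftrightarrow> key w (a, b) < key w (c, d)"
      if "w \<in> set ws" for w
      unfolding L[OF that] key_def
      by (rule layout.line_order_distinct_roots[OF lay[OF that] a c b d False])
    note bounds = layout.key_bounds[OF lay, folded key_def]
      and roots = layout.key_root[OF lay, folded key_def]
    show ?thesis
    proof
      assume "((a, b), (c, d)) \<in> graft Q T \<rho>"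
      then have Q: "(a, c) \<in> Q" "(b, \<rho> a) \<in> T a" "(\<rho> c, d) \<in> T c"
        using False by (auto simp: graft_def)
      show "\<forall>w \<in> set ws. ((a, b), (c, d)) \<in> word_order (L w)"
      proof
        fix w assume w: "w \<in> set ws"
        have "key w (a, b) \<le> rk w a" unfolding rk[OF w] by (rule roots(1)[OF w a Q(2)])
        also have "\<dots> < rk w c" unfolding rk_def by (rule less_root[OF Q(1) False w])
        also have "\<dots> \<le> key w (c, d)" unfolding rk[OF w] by (rule roots(2)[OF w c Q(3)])
        finally show "((a, b), (c, d)) \<in> word_order (L w)" using ord[OF w] by simp
      qed
    next
      assume "\<forall>w \<in> set ws. ((a, b), (c, d)) \<in> word_order (L w)"
      then have all: "key w (a, b) < key w (c, d)" if "w \<in> set ws" for w using ord that by blast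
      \<comment> \<open>A pair \<open>c < a\<close> is refuted by its third word.\<close>
      have not_rev: "(c, a) \<notin> Q"
      proof
        assume ca: "(c, a) \<in> Q"
        then obtain w where w: "w \<in> set ws" "shp w c \<noteq> Early" "shp w a \<noteq> Late"
          using third False by blast
        have "key w (c, d) \<le> rk w c" unfolding rk[OF w(1)] by (rule roots(3)[OF w(1) c w(2)])
        also have "\<dots> < rk w a" unfolding rk_def using less_root[OF ca _ w(1)] False by blast
        also have "\<dots> \<le> key w (a, b)" unfolding rk[OF w(1)] by (rule roots(4)[OF w(1) a w(3)])
        finally show False using all[OF w(1)] by simp
      qed
      \<comment> \<open>For incomparable vertices some word has the whole span of \<open>c\<close> before that of \<open>a\<close>.\<close>
      have ac: "(a, c) \<in> Q"
      proof (rule ccontr)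
        assume "(a, c) \<notin> Q"
        then obtain w where w: "w \<in> set ws" "hi w c < lo w a"
          using parallel[OF c a not_rev] by blast
        then show False
          using all[OF w(1)] bounds(1)[OF w(1) a, of b] bounds(2)[OF w(1) c, of d] by order
      qed
      \<comment> \<open>Otherwise \<open>b\<close> is in the second piece of \<open>a\<close> where \<open>a\<close> is \<open>Early\<close>, hence after all of \<open>T\<^sub>c\<close>.\<close>
      have "(b, \<rho> a) \<in> T a"
      proof (rule ccontr)
        assume nb: "(b, \<rho> a) \<notin> T a"
        obtain w where w: "w \<in> set ws" "shp w a = Early" using all_shapes a by blast
        then have "key w (a, b) = hi w a"
          using nb by (simp add: key_def layout.key_def[OF lay[OF w(1)]])
        then show False
          using all[OF w(1)] bounds(2)[OF w(1) c, of d] less_hi[OF ac False w] by order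
      qed
      \<comment> \<open>Dually, \<open>d\<close> would be in the first piece of \<open>c\<close> where \<open>c\<close> is \<open>Late\<close>.\<close>
      moreover have "(\<rho> c, d) \<in> T c"
      proof (rule ccontr)
        assume nd: "(\<rho> c, d) \<notin> T c"
        obtain w where w: "w \<in> set ws" "shp w c = Late" using all_shapes c by blast
        then have "key w (c, d) = lo w c"
          using nd by (simp add: key_def layout.key_def[OF lay[OF w(1)]])
        then show False
          using all[OF w(1)] bounds(1)[OF w(1) a, of b] less_lo[OF ac False w] by order
      qed
      ultimately show "((a, b), (c, d)) \<in> graft Q T \<rho>"
        using ac a c False by (simp add: graft_def)
    qed
  qed
  show ?thesis
  proof (rule realizer_if_rel_iff)
    fix M assume "M \<in> set (map (\<lambda>w. concat (map (spell \<rho> W) (ts w))) ws)"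
    then obtain w where w: "w \<in> set ws" "M = L w" by (auto simp: L_def)
    show "distinct M \<and> set M = Field (graft Q T \<rho>)"
      unfolding w(2) L[OF w(1)] F
      using layout.distinct_line[OF lay[OF w(1)]] layout.set_line[OF lay[OF w(1)]] by simp
  next
    fix u v assume "u \<in> Field (graft Q T \<rho>)" "v \<in> Field (graft Q T \<rho>)"
    then show "(u, v) \<in> graft Q T \<rho> \<longleftrightarrow>
        (\<forall>M \<in> set (map (\<lambda>w. concat (map (spell \<rho> W) (ts w))) ws). (u, v) \<in> word_order M)"
      using main unfolding F L_def by auto
  qed
qed

section \<open>The order of a cycle poset\<close>

text \<open>The places on the cycle, in cyclic order \<open>sx 1, so 1, sz 1, se 1, sx 2, so 2, \<dots>, sz n, se n\<close>.  The new
elements of the chain with number \<open>2 * i - 1\<close>, from \<open>x\<^sub>i\<close> to \<open>z\<^sub>i\<close>, form the site \<open>so i\<close>, and those of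
the chain with number \<open>2 * i\<close>, from \<open>x\<^sub>i\<^sub>+\<^sub>1\<close> to \<open>z\<^sub>i\<close>, form \<open>se i\<close>.  Two separate constructors avoid
reasoning about parity.\<close>

datatype site = sx nat | so nat | sz nat | se nat

fun site_of :: "vert \<Rightarrow> site" where
  "site_of (vx i) = sx i"
| "site_of (vz i) = sz i"
| "site_of (vy p j) = (if odd p then so ((p + 1) div 2) else se (p div 2))"

definition cyc_pred :: "nat \<Rightarrow> nat \<Rightarrow> nat" where
  "cyc_pred n i = (if i = 1 then n else i - 1)"

fun below :: "nat \<Rightarrow> site \<Rightarrow> site \<Rightarrow> bool" where
  "below n (sx i) (so j) \<longleftrightarrow> j = i"
| "below n (sx i) (se j) \<longleftrightarrow> j = cyc_pred n i"
| "below n (sx i) (sz j) \<longleftrightarrow> j = i \<or> j = cyc_pred n i"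
| "below n (so i) (sz j) \<longleftrightarrow> j = i"
| "below n (se i) (sz j) \<longleftrightarrow> j = i"
| "below n _ _ \<longleftrightarrow> False"

definition cycle_verts :: "nat \<Rightarrow> (nat \<Rightarrow> nat) \<Rightarrow> vert set" where
  "cycle_verts n k = vx ` {1..n} \<union> vz ` {1..n} \<union> (\<Union>p \<in> {1..2 * n}. vy p ` {1..k p})"

definition before :: "nat \<Rightarrow> vert \<Rightarrow> vert \<Rightarrow> bool" where
  "before n u v \<longleftrightarrow> below n (site_of u) (site_of v) \<or> (\<exists>p i j. u = vy p i \<and> v = vy p j \<and> i < j)"

lemma before_trans: "before n u v \<Longrightarrow> before n v w \<Longrightarrow> before n u w"
  unfolding before_def by (cases u; cases v; cases w) (auto split: if_splits)

lemma length_cyc_chain: "length (cyc_chain n k p) = k p + 2"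
  by (simp add: cyc_chain_def)

lemma nth_cyc_chain:
  "cyc_chain n k p ! 0 = vx (cyc n (p div 2 + 1))"
  "1 \<le> i \<Longrightarrow> i \<le> k p \<Longrightarrow> cyc_chain n k p ! i = vy p i"
  "cyc_chain n k p ! (k p + 1) = vz ((p + 1) div 2)"
  by (auto simp: cyc_chain_def nth_Cons' nth_append)

lemma set_cyc_chain:
  "set (cyc_chain n k p) = {vx (cyc n (p div 2 + 1)), vz ((p + 1) div 2)} \<union> vy p ` {1..k p}"
proof -
  have "{1..<Suc (k p)} = {1..k p}" by auto
  then show ?thesis by (auto simp: cyc_chain_def)
qed

lemma cyc_cases: "1 \<le> i \<Longrightarrow> i \<le> n \<Longrightarrow> cyc n i = i" "1 \<le> n \<Longrightarrow> cyc n (Suc n) = 1"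
  by (auto simp: cyc_def)

lemma chain_cases:
  assumes "p \<in> {1..2 * n}"
  obtains i where "i \<in> {1..n}" "p = 2 * i - 1" "odd p" "(p + 1) div 2 = i" "cyc n (p div 2 + 1) = i"
  | i where "i \<in> {1..n}" "p = 2 * i" "even p" "(p + 1) div 2 = i" "p div 2 = i"
     "cyc n (p div 2 + 1) \<in> {1..n}" "cyc_pred n (cyc n (p div 2 + 1)) = i"
proof (cases "even p")
  case True
  then obtain i where i: "p = 2 * i" by blast
  then have "i \<in> {1..n}" using assms by auto
  then show thesis
    using that(2)[of i] i True cyc_cases(1)[of "Suc i" n] cyc_cases(2)[of n]
    by (cases "i = n") (auto simp: cyc_pred_def)
next
  case False
  then obtain i where i: "p = 2 * i + 1" by (auto elim: oddE)
  then show thesis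
    using that(1)[of "Suc i"] assms False cyc_cases(1)[of "Suc i" n] by auto
qed

lemma Union_cyc_chain:
  assumes "1 \<le> n"
  shows "(\<Union>p \<in> {1..2 * n}. set (cyc_chain n k p)) = cycle_verts n k"
proof (intro equalityI UN_least subsetI)
  fix p u assume p: "p \<in> {1..2 * n}" and "u \<in> set (cyc_chain n k p)"
  then have "u = vx (cyc n (p div 2 + 1)) \<or> u = vz ((p + 1) div 2) \<or> u \<in> vy p ` {1..k p}"
    by (auto simp: set_cyc_chain)
  moreover have "cyc n (p div 2 + 1) \<in> {1..n} \<and> (p + 1) div 2 \<in> {1..n}"
    by (rule chain_cases[OF p]) metis+
  ultimately show "u \<in> cycle_verts n k"
    using p by (auto simp: cycle_verts_def)
next
  fix u assume u: "u \<in> cycle_verts n k"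
  show "u \<in> (\<Union>p \<in> {1..2 * n}. set (cyc_chain n k p))"
  proof (cases u)
    case (vy p j)
    with u show ?thesis by (intro UN_I[of p]) (auto simp: cycle_verts_def set_cyc_chain)
  next
    case (vx i)
    with u have i: "i \<in> {1..n}" by (auto simp: cycle_verts_def)
    then have "(2 * i - 1) div 2 + 1 = i" by auto
    then show ?thesis using vx i cyc_cases(1)[of i n]
      by (intro UN_I[of "2 * i - 1"]) (auto simp: set_cyc_chain)
  next
    case (vz i)
    with u have i: "i \<in> {1..n}" by (auto simp: cycle_verts_def)
    then show ?thesis using vz
      by (intro UN_I[of "2 * i - 1"]) (auto simp: set_cyc_chain)
  qed
qed

lemma chain_before:
  assumes "p \<in> {1..2 * n}" "i < j" "j < length (cyc_chain n k p)"
  shows "before n (cyc_chain n k p ! i) (cyc_chain n k p ! j)"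
proof -
  have j: "(1 \<le> j \<and> j \<le> k p) \<or> j = k p + 1"
    using assms(2,3) unfolding length_cyc_chain by linarith
  have i: "i = 0 \<or> (1 \<le> i \<and> i \<le> k p)"
    using assms(2,3) unfolding length_cyc_chain by linarith
  show ?thesis
    using assms(1)
  proof (cases rule: chain_cases)
    case (1 h)
    then show ?thesis using i j assms(2) by (auto simp: nth_cyc_chain[simplified] before_def)
  next
    case (2 h)
    then show ?thesis using i j assms(2) by (auto simp: nth_cyc_chain[simplified] before_def)
  qed
qed

text \<open>Together with \<open>chain_before\<close> this shows that \<open>before\<close> relates exactly the pairs on a common chain.
Since \<open>before\<close> is transitive, closing the covers under transitivity adds no pair across chains.\<close>

lemma before_on_chain:
  assumes "1 \<le> n" "before n u v" "u \<in> cycle_verts n k" "v \<in> cycle_verts n k"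
  obtains p i j where "p \<in> {1..2 * n}" "i < j" "j < length (cyc_chain n k p)"
    "u = cyc_chain n k p ! i" "v = cyc_chain n k p ! j"
proof -
  have odd_chain: "2 * i - 1 \<in> {1..2 * n}" "(2 * i - 1) div 2 + 1 = i" "(2 * i - 1 + 1) div 2 = i"
      "cyc n ((2 * i - 1) div 2 + 1) = i" if "i \<in> {1..n}" for i
  proof -
    show half: "(2 * i - 1) div 2 + 1 = i" using that by auto
    show "cyc n ((2 * i - 1) div 2 + 1) = i" unfolding half using that cyc_cases(1)[of i n] by simp
  qed (use that in auto)
  have even_chain: "2 * j \<in> {1..2 * n}" "(2 * j) div 2 = j" "(2 * j + 1) div 2 = j"
      "cyc n ((2 * j) div 2 + 1) = i" if "j = cyc_pred n i" "i \<in> {1..n}" for i j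
    using that cyc_cases(1)[of i n] cyc_cases(2)[of n] by (auto simp: cyc_pred_def split: if_splits)
  note nth = nth_cyc_chain(1) nth_cyc_chain(3) length_cyc_chain
  show thesis
  proof (cases u)
    case (vx i)
    then have i: "i \<in> {1..n}" using assms(3) by (auto simp: cycle_verts_def)
    show thesis
    proof (cases v)
      case (vx i')
      then show thesis using assms(2) \<open>u = vx i\<close> by (simp add: before_def)
    next
      case (vz j)
      then have "j = i \<or> j = cyc_pred n i" using assms(2) \<open>u = vx i\<close> by (simp add: before_def)
      then show thesis
      proof
        assume "j = i"
        then show thesis using that[of "2 * i - 1" 0 "k (2 * i - 1) + 1"] vx vz odd_chain[OF i]
          unfolding nth by auto
      next
        assume "j = cyc_pred n i"
        then show thesis using that[of "2 * j" 0 "k (2 * j) + 1"] vx vz even_chain[OF _ i, of j]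
          unfolding nth by auto
      qed
    next
      case (vy p j)
      then have p: "p \<in> {1..2 * n}" and j: "1 \<le> j" "j \<le> k p"
        using assms(4) by (auto simp: cycle_verts_def)
      have "cyc n (p div 2 + 1) = i"
      proof (cases "odd p")
        case True
        then have "(p + 1) div 2 = i" using assms(2) vx vy by (simp add: before_def)
        then show ?thesis using chain_cases[OF p] True by metis
      next
        case False
        then have "p div 2 = cyc_pred n i" using assms(2) vx vy by (simp add: before_def)
        then show ?thesis using even_chain(4)[of "p div 2" i] i False by simp
      qed
      then show thesis
        using that[of p 0 j] p j vx vy nth_cyc_chain(2)[of j k p n]  unfolding nth by auto
    qed
  next
    case (vz i)
    then show thesis using assms(2) by (simp add: before_def)
  next
    case (vy p i)
    then have p: "p \<in> {1..2 * n}" and i: "1 \<le> i" "i \<le> k p"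
      using assms(3) by (auto simp: cycle_verts_def)
    show thesis
    proof (cases v)
      case (vx i')
      then show thesis using assms(2) vy by (simp add: before_def split: if_splits)
    next
      case (vz j)
      then have "j = (p + 1) div 2" using assms(2) vy by (auto simp: before_def split: if_splits)
      then show thesis
        using that[of p i "k p + 1"] p i vz vy nth_cyc_chain(2)[of i k p n] unfolding nth by auto
    next
      case (vy q j)
      then have "q = p" "i < j" using assms(2) \<open>u = vy p i\<close> by (auto simp: before_def split: if_splits)
      moreover have "1 \<le> j" "j \<le> k q" using assms(4) vy by (auto simp: cycle_verts_def)
      ultimately show thesis
        using that[of p i j] p i vy \<open>u = vy p i\<close> nth_cyc_chain(2)[of _ k p n] unfolding nth by auto
    qed
  qed
qed

lemma nth_trancl_steps:
  assumes "i < j" "j < length L"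
  shows "(L ! i, L ! j) \<in> {(L ! i, L ! Suc i) | i. Suc i < length L}\<^sup>+"
  using assms
proof (induction j)
  case (Suc j)
  have step: "(L ! j, L ! Suc j) \<in> {(L ! i, L ! Suc i) | i. Suc i < length L}"
    using Suc.prems by blast
  show ?case
  proof (cases "i = j")
    case True
    then show ?thesis using step by blast
  next
    case False
    then show ?thesis using Suc step by (auto intro: trancl_into_trancl)
  qed
qed simp

lemma cycle_poset_iff:
  assumes "1 \<le> n"
  shows "(u, v) \<in> cycle_poset n k \<longleftrightarrow>
    u \<in> cycle_verts n k \<and> v \<in> cycle_verts n k \<and> (u = v \<or> before n u v)"
proof -
  let ?c = "cyc_chain n k"
  let ?S = "\<Union>p \<in> {1..2 * n}. {(?c p ! i, ?c p ! Suc i) | i. Suc i < length (?c p)}"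
  let ?R = "{(u, v). u \<in> cycle_verts n k \<and> v \<in> cycle_verts n k \<and> before n u v}"
  have "?S \<subseteq> ?R"
  proof (intro UN_least subsetI)
    fix p e assume p: "p \<in> {1..2 * n}" and "e \<in> {(?c p ! i, ?c p ! Suc i) | i. Suc i < length (?c p)}"
    then obtain i where e: "e = (?c p ! i, ?c p ! Suc i)" "Suc i < length (?c p)" by blast
    then have "?c p ! i \<in> set (?c p)" "?c p ! Suc i \<in> set (?c p)" by simp_all
    then have "?c p ! i \<in> cycle_verts n k" "?c p ! Suc i \<in> cycle_verts n k"
      using Union_cyc_chain[OF assms, of k] p by blast+
    then show "e \<in> ?R" using chain_before[OF p _ e(2), of i] e(1) by simp
  qed
  moreover have "?R\<^sup>+ = ?R"
    by (rule trancl_id) (auto simp: trans_def intro: before_trans)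
  ultimately have "?S\<^sup>+ \<subseteq> ?R" using trancl_mono_subset by blast
  moreover have "?R \<subseteq> ?S\<^sup>+"
  proof (rule subrelI)
    fix u v assume "(u, v) \<in> ?R"
    then obtain p i j where p: "p \<in> {1..2 * n}" "i < j" "j < length (?c p)" "u = ?c p ! i" "v = ?c p ! j"
      using before_on_chain[OF assms] by blast
    have "(u, v) \<in> {(?c p ! i, ?c p ! Suc i) | i. Suc i < length (?c p)}\<^sup>+"
      using nth_trancl_steps[OF p(2,3)] p(4,5) by simp
    moreover have "{(?c p ! i, ?c p ! Suc i) | i. Suc i < length (?c p)} \<subseteq> ?S" using p(1) by blast
    ultimately show "(u, v) \<in> ?S\<^sup>+" by (rule trancl_mono)
  qed
  ultimately have "?S\<^sup>+ = ?R" by (rule equalityI)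
  then show ?thesis
    unfolding cycle_poset_def Union_cyc_chain[OF assms] by auto
qed

lemma Field_cycle_poset:
  assumes "1 \<le> n"
  shows "Field (cycle_poset n k) = cycle_verts n k"
  using cycle_poset_iff[OF assms, of _ _ k] by (auto simp: Field_def)

lemma in_cycle_verts [simp]:
  "vx i \<in> cycle_verts n k \<longleftrightarrow> i \<in> {1..n}"
  "vz i \<in> cycle_verts n k \<longleftrightarrow> i \<in> {1..n}"
  "vy p j \<in> cycle_verts n k \<longleftrightarrow> p \<in> {1..2 * n} \<and> j \<in> {1..k p}"
  unfolding cycle_verts_def by blast+


section \<open>Positions of the sites in the three words\<close>

text \<open>For each site the table gives its shape in the word and the numbers of the blocks that contain its
first and its last token.  A block is a single token, or all tokens of one kind that belong to one
chain.  The blocks of the word are numbered consecutively, apart from a few gaps: the factor with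
index \<open>i\<close> of the large product owns the blocks from \<open>7 * i\<close> to \<open>7 * i + 6\<close> in the first word, from
\<open>8 * i\<close> to \<open>8 * i + 7\<close> in the second one, and from \<open>- 5 * i\<close> to \<open>- 5 * i + 4\<close> in the third one, where
the product is descending.  The blocks before and after the product continue this numbering; in
particular the factors outside the product that resemble those inside it, with index \<open>2\<close> in the
first two words and \<open>n - 1\<close> in the second word, are numbered as if they belonged to it.  A vertex
with index \<open>i\<close> can owe its blocks to the factor \<open>i - 1\<close>, as \<open>sx i\<close> does with \<open>7 * i - 5 = 7 * (i - 1) + 2\<close>.\<close>

fun table1 :: "nat \<Rightarrow> site \<Rightarrow> shape \<times> int \<times> int" where
  "table1 n (sx i) =
    (if i = 1 then (Early, 7, 7 * int n + 4) else if i = 2 then (Late, 5, 9)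
     else (Early, 7 * int i - 5, if i = n then 7 * int n + 3 else 7 * int i + 6))"
| "table1 n (so i) =
    (if i = 1 then (Late, 6, 8) else if i = n then (Early, 7 * int n, 7 * int n + 2)
     else (Whole, 7 * int i, 7 * int i))"
| "table1 n (sz i) =
    (if i = 1 then (Late, 4, 11) else if i = n then (Whole, 7 * int n + 1, 7 * int n + 1)
     else (Early, 7 * int i + 4, 7 * int i + 5))"
| "table1 n (se i) =
    (if i = 1 then (Early, 10, 12) else if i = n then (Whole, 13, 13)
     else (Late, 7 * int i + 1, 7 * int i + 3))"

fun table2 :: "nat \<Rightarrow> site \<Rightarrow> shape \<times> int \<times> int" where
  "table2 n (sx i) =
    (if i = 1 then (Whole, 8 * int n + 2, 8 * int n + 2) else if i = 2 then (Whole, 14, 14)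
     else (Late, 8 * int i - 7, 8 * int i - 6))"
| "table2 n (so i) =
    (if i = 1 then (Early, 8 * int n + 5, 8 * int n + 7) else if i = 2 then (Late, 13, 15)
     else if i = n then (Whole, 8 * int n, 8 * int n) else (Early, 8 * int i + 3, 8 * int i + 7))"
| "table2 n (sz i) =
    (if i = 1 then (Whole, 8 * int n + 6, 8 * int n + 6) else if i = 2 then (Late, 12, 21)
     else if i = n then (Early, 8 * int n + 4, 8 * int n + 8)
     else (Late, 8 * int i - 8, 8 * int i + 5))"
| "table2 n (se i) =
    (if i = 1 then (Whole, 23, 23) else if i = n then (Late, 8 * int n + 1, 8 * int n + 3)
     else (Early, 8 * int i + 4, 8 * int i + 6))"

fun table3 :: "nat \<Rightarrow> site \<Rightarrow> shape \<times> int \<times> int" where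
  "table3 n (sx i) =
    (if i = 1 then (Late, - 5 * int n - 4, - 5 * int n - 3) else if i = 2 then (Early, - 8, - 1)
     else if i = n then (Whole, - 5 * int n - 1, - 5 * int n - 1)
     else (Whole, - 5 * int i + 2, - 5 * int i + 2))"
| "table3 n (so i) =
    (if i = 1 then (Whole, - 5 * int n + 4, - 5 * int n + 4) else if i = 2 then (Early, - 6, - 4)
     else if i = n then (Late, - 5 * int n - 2, - 5 * int n)
     else (Late, - 5 * int i + 1, - 5 * int i + 3))"
| "table3 n (sz i) =
    (if i = 1 then (Early, - 3, - 2) else if i = 2 then (Whole, - 5, - 5)
     else if i = n then (Late, - 5 * int n - 5, - 5 * int n + 2)
     else (Whole, - 5 * int i + 4, - 5 * int i + 4))"
| "table3 n (se i) =
    (if i = 1 then (Late, - 9, - 7) else if i = n then (Early, - 5 * int n + 1, - 5 * int n + 3)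
     else (Whole, - 5 * int i, - 5 * int i))"

fun site_index :: "site \<Rightarrow> nat" where
  "site_index (sx i) = i"
| "site_index (so i) = i"
| "site_index (sz i) = i"
| "site_index (se i) = i"

abbreviation sites :: "nat \<Rightarrow> site set" where
  "sites n \<equiv> {s. site_index s \<in> {1..n}}"

definition table :: "nat \<Rightarrow> nat \<Rightarrow> site \<Rightarrow> shape \<times> int \<times> int" where
  "table n w = (if w = 1 then table1 n else if w = 2 then table2 n else table3 n)"

definition site_shape :: "nat \<Rightarrow> nat \<Rightarrow> site \<Rightarrow> shape" where
  "site_shape n w s = fst (table n w s)"

definition first_block :: "nat \<Rightarrow> nat \<Rightarrow> site \<Rightarrow> int" where
  "first_block n w s = fst (snd (table n w s))"

definition last_block :: "nat \<Rightarrow> nat \<Rightarrow> site \<Rightarrow> int" where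
  "last_block n w s = snd (snd (table n w s))"

definition root_block :: "nat \<Rightarrow> nat \<Rightarrow> site \<Rightarrow> int" where
  "root_block n w s = (if site_shape n w s = Late then last_block n w s else first_block n w s)"

lemmas table_defs = table_def site_shape_def first_block_def last_block_def root_block_def

lemma blocks_of_shape:
  assumes "n \<ge> 4" "s \<in> sites n" "w \<in> {1, 2, 3}"
  shows "if site_shape n w s = Whole then first_block n w s = last_block n w s
    else first_block n w s < last_block n w s"
  using assms by (cases s) (auto simp: table_defs)

lemma shapes_distinct:
  assumes "n \<ge> 4" "s \<in> sites n"
  shows "distinct [site_shape n 1 s, site_shape n 2 s, site_shape n 3 s]"
  using assms by (cases s) (auto simp: table_defs)

lemma index_cases:
  assumes "n \<ge> 4" "s \<in> sites n"
  obtains "site_index s = 1" | "site_index s = 2" | "3 \<le> site_index s" "site_index s < n"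
    | "site_index s = n"
proof -
  have "site_index s = 1 \<or> site_index s = 2 \<or> 3 \<le> site_index s \<and> site_index s < n \<or> site_index s = n"
    using assms by auto
  then show thesis using assms(1) that by (elim disjE conjE) simp_all
qed


lemma below_blocks:
  assumes "n \<ge> 4" "s \<in> sites n" "t \<in> sites n" "below n s t" "w \<in> {1, 2, 3}"
  shows "root_block n w s < root_block n w t"
    and "site_shape n w s = Early \<Longrightarrow> last_block n w t < last_block n w s"
    and "site_shape n w t = Late \<Longrightarrow> first_block n w t < first_block n w s"
proof -
  have "below n s t \<longrightarrow> root_block n w s < root_block n w t \<and>
      (site_shape n w s = Early \<longrightarrow> last_block n w t < last_block n w s) \<and>
      (site_shape n w t = Late \<longrightarrow> first_block n w t < first_block n w s)"
    using assms(1,5)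
    by - (rule index_cases[OF assms(1,2)]; rule index_cases[OF assms(1,3)];
        cases s; cases t; auto simp: table_defs cyc_pred_def)
  then show "root_block n w s < root_block n w t"
    and "site_shape n w s = Early \<Longrightarrow> last_block n w t < last_block n w s"
    and "site_shape n w t = Late \<Longrightarrow> first_block n w t < first_block n w s"
    using assms(4) by blast+
qed

text \<open>Inside the product the word to use depends on the order of the indices: the first or the second
word serves when the index of \<open>s\<close> is smaller, and the third word, which runs downwards, when it is
larger.  The exceptional sites are a matter of finitely many cases.  Equality and comparability
stand in the conclusion, so that the premises of each case are only bounds on the indices.\<close>

lemma parallel_blocks:
  assumes "n \<ge> 4" "s \<in> sites n" "t \<in> sites n"
  shows "s = t \<or> below n s t \<or> below n t s \<or> last_block n 1 s < first_block n 1 t \<or>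
    last_block n 2 s < first_block n 2 t \<or> last_block n 3 s < first_block n 3 t"
  using assms(1)
  by - (rule index_cases[OF assms(1,2)]; rule index_cases[OF assms(1,3)];
      cases s; cases t; simp add: table_defs cyc_pred_def; 
      (* Linear arithmetic refutes the negated goal over the rationals; for some pairs it is only
         contradictory over the integers, and comparing the indices first closes that gap. *)
      (linarith | (cases "site_index s < site_index t"; simp; linarith)))

section \<open>The three words as token lists\<close>

text \<open>Keys are pairs of a block number and a position in the block, ordered lexicographically.  Inside a
block only elements of one chain meet, and they are listed upwards or downwards along the chain.
The descending products in \<open>A\<^sub>p\<close> and \<open>B\<^sub>p\<close> are those of the pieces without the root, which explains the
signs.  So the spans of the elements of one chain are nested, with the top element outermost in a
\<open>Late\<close> chain and the bottom element outermost in an \<open>Early\<close> chain.\<close>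

definition height :: "vert \<Rightarrow> int" where
  "height v = (case v of vy p j \<Rightarrow> int j | _ \<Rightarrow> 0)"

definition vert_shape :: "nat \<Rightarrow> nat \<Rightarrow> vert \<Rightarrow> shape" where
  "vert_shape n w v = site_shape n w (site_of v)"

definition vert_lo :: "nat \<Rightarrow> nat \<Rightarrow> vert \<Rightarrow> int \<times> int" where
  "vert_lo n w v =
    (first_block n w (site_of v), if vert_shape n w v = Late then - height v else height v)"

definition vert_hi :: "nat \<Rightarrow> nat \<Rightarrow> vert \<Rightarrow> int \<times> int" where
  "vert_hi n w v =
    (last_block n w (site_of v), if vert_shape n w v = Early then - height v else height v)"

abbreviation tkey :: "nat \<Rightarrow> nat \<Rightarrow> token \<Rightarrow> int \<times> int" where
  "tkey n w \<equiv> token_key (vert_lo n w) (vert_hi n w)"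

definition A_tokens :: "(nat \<Rightarrow> nat) \<Rightarrow> nat \<Rightarrow> token list \<Rightarrow> token list" where
  "A_tokens k p ts = prod_down 1 (k p) (\<lambda>j. [LateFst (vy p j)]) @ ts @
     prod_up 1 (k p) (\<lambda>j. [LateSnd (vy p j)])"

definition B_tokens :: "(nat \<Rightarrow> nat) \<Rightarrow> nat \<Rightarrow> token list \<Rightarrow> token list" where
  "B_tokens k p ts = prod_up 1 (k p) (\<lambda>j. [EarlyFst (vy p j)]) @ ts @
     prod_down 1 (k p) (\<lambda>j. [EarlySnd (vy p j)])"

definition C_tokens :: "(nat \<Rightarrow> nat) \<Rightarrow> nat \<Rightarrow> token list" where
  "C_tokens k p = prod_up 1 (k p) (\<lambda>j. [Single (vy p j)])"

definition tokens1 :: "(nat \<Rightarrow> nat) \<Rightarrow> nat \<Rightarrow> token list" where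
  "tokens1 k n =
     [LateFst (vz 1)] @ [LateFst (vx 2)] @ A_tokens k 1 [EarlyFst (vx 1)] @ [LateSnd (vx 2)] @
     B_tokens k 2 [LateSnd (vz 1)] @ C_tokens k (2 * n) @
     C_tokens k 3 @ A_tokens k 4 [EarlyFst (vx 3)] @ [EarlyFst (vz 2)] @ [EarlySnd (vz 2)] @
     prod_up 3 (n - 1) (\<lambda>i.
       C_tokens k (2 * i - 1) @ A_tokens k (2 * i) [EarlyFst (vx (i + 1))] @ [EarlyFst (vz i)] @
       [EarlySnd (vz i)] @ [EarlySnd (vx i)]) @
     B_tokens k (2 * n - 1) [Single (vz n)] @ [EarlySnd (vx n)] @ [EarlySnd (vx 1)]"

definition tokens2 :: "(nat \<Rightarrow> nat) \<Rightarrow> nat \<Rightarrow> token list" where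
  "tokens2 k n =
     [LateFst (vz 2)] @ A_tokens k 3 [Single (vx 2)] @
     [LateFst (vz 3)] @ [LateFst (vx 3)] @ [LateSnd (vx 3)] @ B_tokens k 4 [LateSnd (vz 2)] @
     C_tokens k 2 @
     prod_up 3 (n - 2) (\<lambda>i.
       [LateFst (vz (i + 1))] @ [LateFst (vx (i + 1))] @ [LateSnd (vx (i + 1))] @
       B_tokens k (2 * i - 1) (B_tokens k (2 * i) [LateSnd (vz i)])) @
     [LateFst (vx n)] @ [LateSnd (vx n)] @
     B_tokens k (2 * n - 3) (B_tokens k (2 * n - 2) [LateSnd (vz (n - 1))]) @
     C_tokens k (2 * n - 1) @ A_tokens k (2 * n) [Single (vx 1)] @ [EarlyFst (vz n)] @
     B_tokens k 1 [Single (vz 1)] @ [EarlySnd (vz n)]"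

definition tokens3 :: "(nat \<Rightarrow> nat) \<Rightarrow> nat \<Rightarrow> token list" where
  "tokens3 k n =
     [LateFst (vz n)] @ [LateFst (vx 1)] @ [LateSnd (vx 1)] @ A_tokens k (2 * n - 1) [Single (vx n)] @
     B_tokens k (2 * n) [LateSnd (vz n)] @ C_tokens k 1 @
     prod_down 3 (n - 1) (\<lambda>i.
       C_tokens k (2 * i) @ A_tokens k (2 * i - 1) [Single (vx i)] @ [Single (vz i)]) @
     C_tokens k 4 @ A_tokens k 2 [EarlyFst (vx 2)] @ B_tokens k 3 [Single (vz 2)] @
     [EarlyFst (vz 1)] @ [EarlySnd (vz 1)] @ [EarlySnd (vx 2)]"

lemma spell_concat: "concat (map g (concat xss)) = concat (map (\<lambda>xs. concat (map g xs)) xss)"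
  by (induction xss) auto

lemma spell_prod_up: "concat (map g (prod_up a b f)) = prod_up a b (\<lambda>i. concat (map g (f i)))"
  by (simp add: prod_up_def spell_concat comp_def)

lemma spell_prod_down: "concat (map g (prod_down a b f)) = prod_down a b (\<lambda>i. concat (map g (f i)))"
  by (simp add: prod_down_def spell_concat comp_def)

lemma spell_ABC:
  "concat (map (spell \<rho> W) (A_tokens k p ts)) = A_word k \<rho> W p (concat (map (spell \<rho> W) ts))"
  "concat (map (spell \<rho> W) (B_tokens k p ts)) = B_word k \<rho> W p (concat (map (spell \<rho> W) ts))"
  "concat (map (spell \<rho> W) (C_tokens k p)) = C_word k \<rho> W p"
  by (simp_all add: A_tokens_def A_word_def B_tokens_def B_word_def C_tokens_def C_word_def
      spell_prod_up spell_prod_down I_minus_def I_plus_def V_plus_def V_minus_def V_bullet_def)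

lemma spell_tokens:
  "concat (map (spell \<rho> W) (tokens1 k n)) = word1 k \<rho> W n"
  "concat (map (spell \<rho> W) (tokens2 k n)) = word2 k \<rho> W n"
  "concat (map (spell \<rho> W) (tokens3 k n)) = word3 k \<rho> W n"
  by (simp_all add: tokens1_def word1_def tokens2_def word2_def tokens3_def word3_def BB_word_def
      spell_ABC spell_prod_up spell_prod_down)


section \<open>The token lists are sorted\<close>

text \<open>A correct part of a word: sorted tokens that have the prescribed shapes and use blocks from \<open>a\<close> up to
but excluding \<open>b\<close>.  Consecutive parts can be joined without comparing their tokens, which is what
makes words of unbounded length tractable.\<close>

definition chunk :: "nat \<Rightarrow> (nat \<Rightarrow> nat) \<Rightarrow> nat \<Rightarrow> int \<Rightarrow> int \<Rightarrow> token list \<Rightarrow> bool" where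
  "chunk n k w a b ts \<longleftrightarrow> a \<le> b \<and> sorted_wrt (\<lambda>s t. tkey n w s < tkey n w t) ts \<and>
     (\<forall>t \<in> set ts. a \<le> fst (tkey n w t) \<and> fst (tkey n w t) < b \<and>
        (\<exists>v \<in> cycle_verts n k. t \<in> set (tokens (vert_shape n w v) v)))"

lemma chunk_append:
  "chunk n k w a b xs \<Longrightarrow> chunk n k w b c ys \<Longrightarrow> chunk n k w a c (xs @ ys)"
  unfolding chunk_def
  by (auto simp: sorted_wrt_append less_prod_def) (force+)

lemma chunk_weaken:
  "chunk n k w a b xs \<Longrightarrow> a' \<le> a \<Longrightarrow> b \<le> b' \<Longrightarrow> chunk n k w a' b' xs"
  unfolding chunk_def by fastforce

lemma chunk_Nil: "a \<le> b \<Longrightarrow> chunk n k w a b []"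
  by (simp add: chunk_def)

lemma chunk_prod_up:
  assumes "\<And>i. p \<le> i \<Longrightarrow> i \<le> q \<Longrightarrow> chunk n k w (c * int i + d) (c * int i + c + d) (f i)"
    and "p \<le> q + 1" "0 \<le> c"
  shows "chunk n k w (c * int p + d) (c * int q + c + d) (prod_up p q f)"
proof -
  have "chunk n k w (c * int p + d) (c * int (p + m) + d) (concat (map f [p..<p + m]))"
    if "p + m \<le> q + 1" for m
    using that
  proof (induction m)
    case 0
    then show ?case by (simp add: chunk_Nil)
  next
    case (Suc m)
    have "chunk n k w (c * int p + d) (c * int (p + m) + d) (concat (map f [p..<p + m]))"
      using Suc by simp
    moreover have "chunk n k w (c * int (p + m) + d) (c * int (p + Suc m) + d) (f (p + m))"
      using assms(1)[of "p + m"] Suc.prems by (simp add: algebra_simps)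
    ultimately show ?case by (auto intro: chunk_append)
  qed
  from this[of "q + 1 - p"] show ?thesis
    using assms(2) by (simp add: prod_up_def algebra_simps)
qed

lemma chunk_prod_down:
  assumes "\<And>i. p \<le> i \<Longrightarrow> i \<le> q \<Longrightarrow> chunk n k w (d - c * int i) (d - c * int i + c) (f i)"
    and "p \<le> q + 1" "0 \<le> c"
  shows "chunk n k w (d - c * int q) (d - c * int p + c) (prod_down p q f)"
proof -
  have "chunk n k w (d - c * int (p + m) + c) (d - c * int p + c) (concat (map f (rev [p..<p + m])))"
    if "p + m \<le> q + 1" for m
    using that
  proof (induction m)
    case 0
    then show ?case by (simp add: chunk_Nil)
  next
    case (Suc m)
    have "chunk n k w (d - c * int (p + m) + c) (d - c * int p + c) (concat (map f (rev [p..<p + m])))"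
      using Suc by simp
    moreover have "chunk n k w (d - c * int (p + Suc m) + c) (d - c * int (p + m) + c) (f (p + m))"
      using assms(1)[of "p + m"] Suc.prems by (simp add: algebra_simps)
    ultimately show ?case by (auto intro: chunk_append)
  qed
  from this[of "q + 1 - p"] show ?thesis
    using assms(2) by (simp add: prod_down_def algebra_simps)
qed

lemma sorted_wrt_singletons:
  assumes "\<And>i j. a \<le> i \<Longrightarrow> i < j \<Longrightarrow> j \<le> b \<Longrightarrow> R (f i) (f j)"
  shows "sorted_wrt R (prod_up a b (\<lambda>j. [f j]))"
proof -
  have "prod_up a b (\<lambda>j. [f j]) = map f [a..<b + 1]"
    unfolding prod_up_def by (rule concat_map_singleton)
  moreover have "sorted_wrt (\<lambda>i j. R (f i) (f j)) [a..<b + 1]"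
    by (rule sorted_wrt_mono_rel[OF _ sorted_wrt_upt]) (use assms in auto)
  ultimately show ?thesis by (simp only: sorted_wrt_map)
qed

lemma sorted_wrt_singletons_down:
  assumes "\<And>i j. a \<le> i \<Longrightarrow> i < j \<Longrightarrow> j \<le> b \<Longrightarrow> R (f j) (f i)"
  shows "sorted_wrt R (prod_down a b (\<lambda>j. [f j]))"
proof -
  have "prod_down a b (\<lambda>j. [f j]) = rev (prod_up a b (\<lambda>j. [f j]))"
    unfolding prod_down_def prod_up_def concat_map_singleton by (rule rev_map[symmetric])
  then show ?thesis
    using sorted_wrt_singletons[of a b "\<lambda>x y. R y x" f] assms by (simp add: sorted_wrt_rev)
qed

lemma set_prod_up: "set (prod_up a b f) = (\<Union>i \<in> {a..b}. set (f i))"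
proof -
  have "{a..<b + 1} = {a..b}" by auto
  then show ?thesis by (simp add: prod_up_def del: upt_Suc)
qed

lemma set_prod_down: "set (prod_down a b f) = (\<Union>i \<in> {a..b}. set (f i))"
proof -
  have "{a..<b + 1} = {a..b}" by auto
  then show ?thesis by (simp add: prod_down_def del: upt_Suc)
qed

lemma chunk_chain_up:
  assumes "p \<in> {1..2 * n}"
    and "\<And>j. j \<in> {1..k p} \<Longrightarrow> f j \<in> set (tokens (vert_shape n w (vy p j)) (vy p j))"
    and "\<And>j. tkey n w (f j) = (a, int j)"
  shows "chunk n k w a (a + 1) (prod_up 1 (k p) (\<lambda>j. [f j]))"
proof -
  have "sorted_wrt (\<lambda>s t. tkey n w s < tkey n w t) (prod_up 1 (k p) (\<lambda>j. [f j]))"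
    by (rule sorted_wrt_singletons) (simp add: assms(3))
  moreover have "vy p j \<in> cycle_verts n k" if "j \<in> {1..k p}" for j
    using assms(1) that by simp
  ultimately show ?thesis
    unfolding chunk_def set_prod_up using assms(2,3) by fastforce
qed

lemma chunk_chain_down:
  assumes "p \<in> {1..2 * n}"
    and "\<And>j. j \<in> {1..k p} \<Longrightarrow> f j \<in> set (tokens (vert_shape n w (vy p j)) (vy p j))"
    and "\<And>j. tkey n w (f j) = (a, - int j)"
  shows "chunk n k w a (a + 1) (prod_down 1 (k p) (\<lambda>j. [f j]))"
proof -
  have "sorted_wrt (\<lambda>s t. tkey n w s < tkey n w t) (prod_down 1 (k p) (\<lambda>j. [f j]))"
    by (rule sorted_wrt_singletons_down) (simp add: assms(3))
  moreover have "vy p j \<in> cycle_verts n k" if "j \<in> {1..k p}" for j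
    using assms(1) that by simp
  ultimately show ?thesis
    unfolding chunk_def set_prod_down using assms(2,3) by fastforce
qed

lemma chunk_A:
  assumes "p \<in> {1..2 * n}" "site_shape n w (site_of (vy p 0)) = Late"
    and "a \<le> first_block n w (site_of (vy p 0))"
    and "chunk n k w (first_block n w (site_of (vy p 0)) + 1) b ts"
    and "b \<le> last_block n w (site_of (vy p 0))"
  shows "chunk n k w a (last_block n w (site_of (vy p 0)) + 1) (A_tokens k p ts)"
proof -
  define s where "s = site_of (vy p 0)"
  have site: "site_of (vy p j) = s" for j by (simp add: s_def)
  note assms = assms[unfolded site]
  note simps = vert_shape_def vert_lo_def vert_hi_def height_def site assms(2)
  have 1: "chunk n k w (first_block n w s) (first_block n w s + 1)
      (prod_down 1 (k p) (\<lambda>j. [LateFst (vy p j)]))"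
    by (rule chunk_chain_down[OF assms(1)]) (simp_all add: simps del: site_of.simps)
  have 2: "chunk n k w (last_block n w s) (last_block n w s + 1)
      (prod_up 1 (k p) (\<lambda>j. [LateSnd (vy p j)]))"
    by (rule chunk_chain_up[OF assms(1)]) (simp_all add: simps del: site_of.simps)
  show ?thesis
    unfolding A_tokens_def site
    by (rule chunk_append[OF chunk_weaken[OF 1 assms(3) order.refl]
          chunk_append[OF chunk_weaken[OF assms(4) order.refl assms(5)] 2]])
qed

lemma chunk_B:
  assumes "p \<in> {1..2 * n}" "site_shape n w (site_of (vy p 0)) = Early"
    and "a \<le> first_block n w (site_of (vy p 0))"
    and "chunk n k w (first_block n w (site_of (vy p 0)) + 1) b ts"
    and "b \<le> last_block n w (site_of (vy p 0))"
  shows "chunk n k w a (last_block n w (site_of (vy p 0)) + 1) (B_tokens k p ts)"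
proof -
  define s where "s = site_of (vy p 0)"
  have site: "site_of (vy p j) = s" for j by (simp add: s_def)
  note assms = assms[unfolded site]
  note simps = vert_shape_def vert_lo_def vert_hi_def height_def site assms(2)
  have 1: "chunk n k w (first_block n w s) (first_block n w s + 1)
      (prod_up 1 (k p) (\<lambda>j. [EarlyFst (vy p j)]))"
    by (rule chunk_chain_up[OF assms(1)]) (simp_all add: simps del: site_of.simps)
  have 2: "chunk n k w (last_block n w s) (last_block n w s + 1)
      (prod_down 1 (k p) (\<lambda>j. [EarlySnd (vy p j)]))"
    by (rule chunk_chain_down[OF assms(1)]) (simp_all add: simps del: site_of.simps)
  show ?thesis
    unfolding B_tokens_def site
    by (rule chunk_append[OF chunk_weaken[OF 1 assms(3) order.refl]
          chunk_append[OF chunk_weaken[OF assms(4) order.refl assms(5)] 2]])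
qed

lemma chunk_C:
  assumes "p \<in> {1..2 * n}" "site_shape n w (site_of (vy p 0)) = Whole"
    and "a \<le> first_block n w (site_of (vy p 0))"
  shows "chunk n k w a (first_block n w (site_of (vy p 0)) + 1) (C_tokens k p)"
proof -
  define s where "s = site_of (vy p 0)"
  have site: "site_of (vy p j) = s" for j by (simp add: s_def)
  note assms = assms[unfolded site]
  have "chunk n k w (first_block n w s) (first_block n w s + 1)
      (prod_up 1 (k p) (\<lambda>j. [Single (vy p j)]))"
    by (rule chunk_chain_up[OF assms(1)])
      (simp_all add: vert_shape_def vert_lo_def vert_hi_def height_def site assms(2)
        del: site_of.simps)
  then show ?thesis
    unfolding C_tokens_def site by (rule chunk_weaken[OF _ assms(3) order.refl])
qed

lemma chunk_LateFst:
  "vert_shape n w v = Late \<Longrightarrow> v \<in> cycle_verts n k \<Longrightarrow> a \<le> first_block n w (site_of v) \<Longrightarrow>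
    chunk n k w a (first_block n w (site_of v) + 1) [LateFst v]"
  and chunk_LateSnd:
  "vert_shape n w v = Late \<Longrightarrow> v \<in> cycle_verts n k \<Longrightarrow> a \<le> last_block n w (site_of v) \<Longrightarrow>
    chunk n k w a (last_block n w (site_of v) + 1) [LateSnd v]"
  and chunk_EarlyFst:
  "vert_shape n w v = Early \<Longrightarrow> v \<in> cycle_verts n k \<Longrightarrow> a \<le> first_block n w (site_of v) \<Longrightarrow>
    chunk n k w a (first_block n w (site_of v) + 1) [EarlyFst v]"
  and chunk_EarlySnd:
  "vert_shape n w v = Early \<Longrightarrow> v \<in> cycle_verts n k \<Longrightarrow> a \<le> last_block n w (site_of v) \<Longrightarrow>
    chunk n k w a (last_block n w (site_of v) + 1) [EarlySnd v]"
  and chunk_Single: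
  "vert_shape n w v = Whole \<Longrightarrow> v \<in> cycle_verts n k \<Longrightarrow> a \<le> first_block n w (site_of v) \<Longrightarrow>
    chunk n k w a (first_block n w (site_of v) + 1) [Single v]"
  unfolding chunk_def by (auto simp: vert_lo_def vert_hi_def intro!: bexI[of _ v])

lemmas chunk_intros = chunk_append chunk_A chunk_B chunk_C
  chunk_LateFst chunk_LateSnd chunk_EarlyFst chunk_EarlySnd chunk_Single

lemma site_of_chain:
  "site_of (vy 1 j) = so 1" "site_of (vy (Suc 0) j) = so 1" "site_of (vy 2 j) = se 1"
  "site_of (vy 3 j) = so 2" "site_of (vy 4 j) = se 2"
  "site_of (vy (2 * i) j) = se i"
  "1 \<le> i \<Longrightarrow> site_of (vy (2 * i - 1) j) = so i"
  "1 \<le> i \<Longrightarrow> site_of (vy (2 * i - Suc 0) j) = so i"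
  "2 \<le> i \<Longrightarrow> site_of (vy (2 * i - 2) j) = se (i - 1)"
  "2 \<le> i \<Longrightarrow> site_of (vy (2 * i - 3) j) = so (i - 1)"
  by auto

lemmas place_simps = table_defs vert_shape_def site_of_chain

text \<open>The rules \<open>chunk_intros\<close> walk through the word from left to right.  Each of them ends the part just
treated right behind its last block, so what remains for every token is that its block does not lie
before this point.\<close>

lemma tokens1_chunk:
  assumes "n \<ge> 4"
  shows "\<exists>b. chunk n k 1 4 b (tokens1 k n)"
proof -
  have loop: "chunk n k 1 a (7 * int n) (prod_up 3 (n - 1) (\<lambda>i.
       C_tokens k (2 * i - 1) @ A_tokens k (2 * i) [EarlyFst (vx (i + 1))] @ [EarlyFst (vz i)] @
       [EarlySnd (vz i)] @ [EarlySnd (vx i)]))" (is "chunk _ _ _ _ _ (prod_up _ _ ?f)") if "a \<le> 21" for a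
  proof -
    have "chunk n k 1 (7 * int i + 0) (7 * int i + 7 + 0) (?f i)" if "3 \<le> i" "i < n" for i
    proof (rule chunk_weaken[OF _ order.refl])
      show "chunk n k 1 (7 * int i + 0) (last_block n 1 (site_of (vx i)) + 1) (?f i)"
        using that assms
        by - (rule chunk_intros | (auto simp: place_simps simp del: site_of.simps(3); fail))+
      show "last_block n 1 (site_of (vx i)) + 1 \<le> 7 * int i + 7 + 0"
        using that assms by (simp add: place_simps)
    qed
    then have "chunk n k 1 (7 * int 3 + 0) (7 * int (n - 1) + 7 + 0) (prod_up 3 (n - 1) ?f)"
      using assms by (intro chunk_prod_up) auto
    then show ?thesis
      by (rule chunk_weaken) (use assms that in \<open>auto simp: of_nat_diff\<close>)
  qed
  show ?thesis
    unfolding tokens1_def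
    using assms
    by - (rule exI, (rule chunk_intros loop | (auto simp: place_simps simp del: site_of.simps(3); fail))+)
qed

lemma tokens2_chunk:
  assumes "n \<ge> 4"
  shows "\<exists>b. chunk n k 2 12 b (tokens2 k n)"
proof -
  have loop: "chunk n k 2 a (8 * int n - 8) (prod_up 3 (n - 2) (\<lambda>i.
       [LateFst (vz (i + 1))] @ [LateFst (vx (i + 1))] @ [LateSnd (vx (i + 1))] @
       B_tokens k (2 * i - 1) (B_tokens k (2 * i) [LateSnd (vz i)])))" (is "chunk _ _ _ _ _ (prod_up _ _ ?f)")
      if "a \<le> 24" for a
  proof -
    have "chunk n k 2 (8 * int i + 0) (8 * int i + 8 + 0) (?f i)" if "3 \<le> i" "i + 1 < n" for i
    proof (rule chunk_weaken[OF _ order.refl])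
      show "chunk n k 2 (8 * int i + 0) (last_block n 2 (site_of (vy (2 * i - 1) 0)) + 1) (?f i)"
        using that assms
        by - (rule chunk_intros | (auto simp: place_simps simp del: site_of.simps(3); fail))+
      show "last_block n 2 (site_of (vy (2 * i - 1) 0)) + 1 \<le> 8 * int i + 8 + 0"
        using that assms by (simp add: place_simps del: site_of.simps(3))
    qed
    then have "chunk n k 2 (8 * int 3 + 0) (8 * int (n - 2) + 8 + 0) (prod_up 3 (n - 2) ?f)"
      using assms by (intro chunk_prod_up) auto
    then show ?thesis
      by (rule chunk_weaken) (use assms that in \<open>auto simp: of_nat_diff\<close>)
  qed
  show ?thesis
    unfolding tokens2_def
    using assms
    by - (rule exI, (rule chunk_intros loop | (auto simp: place_simps simp del: site_of.simps(3); fail))+)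
qed

lemma tokens3_chunk:
  assumes "n \<ge> 4"
  shows "\<exists>b. chunk n k 3 (- 5 * int n - 5) b (tokens3 k n)"
proof -
  have loop: "chunk n k 3 a (- 10) (prod_down 3 (n - 1) (\<lambda>i.
       C_tokens k (2 * i) @ A_tokens k (2 * i - 1) [Single (vx i)] @ [Single (vz i)]))"
       (is "chunk _ _ _ _ _ (prod_down _ _ ?f)")
      if "a \<le> 5 - 5 * int n" for a
  proof -
    have "chunk n k 3 (0 - 5 * int i) (0 - 5 * int i + 5) (?f i)" if "3 \<le> i" "i < n" for i
    proof (rule chunk_weaken[OF _ order.refl])
      show "chunk n k 3 (0 - 5 * int i) (first_block n 3 (site_of (vz i)) + 1) (?f i)"
        using that assms
        by - (rule chunk_intros | (auto simp: place_simps simp del: site_of.simps(3); fail))+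
      show "first_block n 3 (site_of (vz i)) + 1 \<le> 0 - 5 * int i + 5"
        using that assms by (simp add: place_simps)
    qed
    then have "chunk n k 3 (0 - 5 * int (n - 1)) (0 - 5 * int 3 + 5) (prod_down 3 (n - 1) ?f)"
      using assms by (intro chunk_prod_down) auto
    then show ?thesis
      by (rule chunk_weaken) (use assms that in \<open>auto simp: of_nat_diff\<close>)
  qed
  show ?thesis
    unfolding tokens3_def
    using assms
    by - (rule exI, (rule chunk_intros loop | (auto simp: place_simps simp del: site_of.simps(3); fail))+)
qed


section \<open>The token lists are complete\<close>

lemma in_ABC_tokens:
  "t \<in> set (A_tokens k p ts) \<longleftrightarrow>
    t \<in> set ts \<or> (\<exists>j. (t = LateFst (vy p j) \<or> t = LateSnd (vy p j)) \<and> 1 \<le> j \<and> j \<le> k p)"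
  "t \<in> set (B_tokens k p ts) \<longleftrightarrow>
    t \<in> set ts \<or> (\<exists>j. (t = EarlyFst (vy p j) \<or> t = EarlySnd (vy p j)) \<and> 1 \<le> j \<and> j \<le> k p)"
  "t \<in> set (C_tokens k p) \<longleftrightarrow> (\<exists>j. t = Single (vy p j) \<and> 1 \<le> j \<and> j \<le> k p)"
  by (auto simp: A_tokens_def B_tokens_def C_tokens_def set_prod_up set_prod_down)

lemma in_prod:
  "t \<in> set (prod_up a b f) \<longleftrightarrow> (\<exists>i. a \<le> i \<and> i \<le> b \<and> t \<in> set (f i))"
  "t \<in> set (prod_down a b f) \<longleftrightarrow> (\<exists>i. a \<le> i \<and> i \<le> b \<and> t \<in> set (f i))"
  by (auto simp: set_prod_up set_prod_down)

lemma site_of_in_sites: "v \<in> cycle_verts n k \<Longrightarrow> site_of v \<in> sites n"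
  by (cases v) (auto, presburger)

lemma site_cases:
  assumes "n \<ge> 4" "v \<in> cycle_verts n k"
  obtains (vx) i where "v = vx i" | (vz) i where "v = vz i"
    | (odd) i j where "v = vy (2 * i - 1) j" "1 \<le> i" "j \<in> {1..k (2 * i - 1)}"
    | (even) i j where "v = vy (2 * i) j" "j \<in> {1..k (2 * i)}"
proof (cases v)
  case (vy p j)
  then have p: "p \<in> {1..2 * n}" and j: "j \<in> {1..k p}" using assms(2) by auto
  show thesis
    using p by (cases rule: chain_cases) (use vy j odd even in auto)
qed (use vx vz in auto)

lemma tokens1_complete:
  assumes "n \<ge> 4" "v \<in> cycle_verts n k"
  shows "set (tokens (vert_shape n 1 v) v) \<subseteq> set (tokens1 k n)"
  using assms(1)
  by - (rule site_cases[OF assms]; rule index_cases[OF assms(1) site_of_in_sites[OF assms(2)]];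
    simp add: place_simps tokens1_def in_prod in_ABC_tokens del: site_of.simps(3);
    (presburger | (intro disjI2; force)))

lemma tokens2_complete:
  assumes "n \<ge> 4" "v \<in> cycle_verts n k"
  shows "set (tokens (vert_shape n 2 v) v) \<subseteq> set (tokens2 k n)"
proof -
  \<comment> \<open>The last factor, with index \<open>n - 1\<close>, is written separately in the second word, with numbers in terms of \<open>n\<close>.\<close>
  have last: "2 * n - 3 = 2 * i - Suc 0" "2 * n - 2 = 2 * i" if "n = Suc i" for i
    using that by auto
  show ?thesis
    using assms(1)
    by - (rule site_cases[OF assms]; rule index_cases[OF assms(1) site_of_in_sites[OF assms(2)]];
      simp add: place_simps tokens2_def in_prod in_ABC_tokens del: site_of.simps(3);
      (presburger | (cases "n = Suc (site_index (site_of v))"; 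
        force simp add: last place_simps simp del: site_of.simps(3))))
qed

lemma tokens3_complete:
  assumes "n \<ge> 4" "v \<in> cycle_verts n k"
  shows "set (tokens (vert_shape n 3 v) v) \<subseteq> set (tokens3 k n)"
  using assms(1)
  by - (rule site_cases[OF assms]; rule index_cases[OF assms(1) site_of_in_sites[OF assms(2)]];
    simp add: place_simps tokens3_def in_prod in_ABC_tokens del: site_of.simps(3);
    (presburger | force | (intro disjI2; force)))


section \<open>The realizer\<close>

lemma vert_shapes_distinct:
  assumes "n \<ge> 4" "v \<in> cycle_verts n k"
  shows "distinct [vert_shape n 1 v, vert_shape n 2 v, vert_shape n 3 v]"
  unfolding vert_shape_def by (rule shapes_distinct[OF assms(1) site_of_in_sites[OF assms(2)]])

lemma before_keys:
  assumes "n \<ge> 4" "a \<in> cycle_verts n k" "c \<in> cycle_verts n k" "before n a c" "w \<in> {1, 2, 3}"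
  shows "(if vert_shape n w a = Late then vert_hi n w a else vert_lo n w a) <
      (if vert_shape n w c = Late then vert_hi n w c else vert_lo n w c)"
    and "vert_shape n w a = Early \<Longrightarrow> vert_hi n w c < vert_hi n w a"
    and "vert_shape n w c = Late \<Longrightarrow> vert_lo n w c < vert_lo n w a"
proof -
  consider (below) "below n (site_of a) (site_of c)"
    | (chain) p i j where "a = vy p i" "c = vy p j" "i < j"
    using assms(4) by (auto simp: before_def)
  note cases = this
  note sites = site_of_in_sites[OF assms(2)] site_of_in_sites[OF assms(3)]
  show "(if vert_shape n w a = Late then vert_hi n w a else vert_lo n w a) <
      (if vert_shape n w c = Late then vert_hi n w c else vert_lo n w c)"
    using cases
  proof cases
    case below
    from below_blocks(1)[OF assms(1) sites this assms(5)] show ?thesis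
      by (auto simp: root_block_def vert_lo_def vert_hi_def vert_shape_def split: if_splits)
  qed (auto simp: vert_lo_def vert_hi_def vert_shape_def height_def)
  show "vert_hi n w c < vert_hi n w a" if "vert_shape n w a = Early"
    using cases
  proof cases
    case below
    from below_blocks(2)[OF assms(1) sites this assms(5)] that show ?thesis
      by (auto simp: vert_hi_def vert_shape_def)
  qed (use that in \<open>auto simp: vert_hi_def vert_shape_def height_def\<close>)
  show "vert_lo n w c < vert_lo n w a" if "vert_shape n w c = Late"
    using cases
  proof cases
    case below
    from below_blocks(3)[OF assms(1) sites this assms(5)] that show ?thesis
      by (auto simp: vert_lo_def vert_shape_def)
  qed (use that in \<open>auto simp: vert_lo_def vert_shape_def height_def\<close>)
qed

text \<open>Distinct vertices share a site only as new elements of the same chain, where they are comparable.\<close>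

lemma site_of_eqD:
  assumes "site_of a = site_of c" "a \<noteq> c"
  obtains p i j where "a = vy p i" "c = vy p j" "i \<noteq> j"
proof -
  have "p = q" if "site_of (vy p i) = site_of (vy q j)" for p q i j
  proof -
    have "(odd p \<longleftrightarrow> odd q) \<and> (p + 1) div 2 = (q + 1) div 2"
      using that by (simp split: if_splits)
    then show ?thesis by presburger
  qed
  note same_chain = this
  show thesis
  proof (cases a)
    case (vy p i)
    then obtain q j where "c = vy q j" using assms by (cases c) (auto split: if_splits)
    then show thesis using that[of p i j] same_chain[of p i q j] assms vy by auto
  qed (use assms in \<open>cases c; simp split: if_splits\<close>)+
qed

lemma parallel_keys:
  assumes "n \<ge> 4" "a \<in> cycle_verts n k" "c \<in> cycle_verts n k" "a \<noteq> c"
    and "\<not> before n a c" "\<not> before n c a"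
  shows "\<exists>w \<in> {1, 2, 3}. vert_hi n w a < vert_lo n w c"
proof -
  have "site_of a \<noteq> site_of c"
  proof
    assume "site_of a = site_of c"
    then obtain p i j where "a = vy p i" "c = vy p j" "i \<noteq> j" using assms(4) by (rule site_of_eqD)
    then show False using assms(5,6) by (auto simp: before_def)
  qed
  moreover have "\<not> below n (site_of a) (site_of c)" "\<not> below n (site_of c) (site_of a)"
    using assms(5,6) by (auto simp: before_def)
  ultimately obtain w where "w \<in> {1, 2, 3}" "last_block n w (site_of a) < first_block n w (site_of c)"
    using parallel_blocks[OF assms(1) site_of_in_sites[OF assms(2)] site_of_in_sites[OF assms(3)]]
    by blast
  then show ?thesis by (intro bexI[of _ w]) (auto simp: vert_lo_def vert_hi_def)
qed

definition tokens_of :: "(nat \<Rightarrow> nat) \<Rightarrow> nat \<Rightarrow> nat \<Rightarrow> token list" where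
  "tokens_of k n w = (if w = 1 then tokens1 k n else if w = 2 then tokens2 k n else tokens3 k n)"

lemma layout_tokens:
  assumes "n \<ge> 4" "w \<in> {1, 2, 3}"
    and "\<And>v. v \<in> cycle_verts n k \<Longrightarrow> rooted_tree_poset (T v) (\<rho> v)"
    and "\<And>v. v \<in> cycle_verts n k \<Longrightarrow> admissible (T v) (\<rho> v) (W v)"
  shows "layout (cycle_verts n k) T \<rho> W (vert_shape n w) (vert_lo n w) (vert_hi n w) (tokens_of k n w)"
proof
  fix v assume v: "v \<in> cycle_verts n k"
  show "if vert_shape n w v = Whole then vert_lo n w v = vert_hi n w v else vert_lo n w v < vert_hi n w v"
    using blocks_of_shape[OF assms(1) site_of_in_sites[OF v] assms(2)]
    by (auto simp: vert_lo_def vert_hi_def vert_shape_def)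
next
  obtain a b where chunk: "chunk n k w a b (tokens_of k n w)"
    using tokens1_chunk[OF assms(1)] tokens2_chunk[OF assms(1)] tokens3_chunk[OF assms(1)] assms(2)
    unfolding tokens_of_def by fastforce
  then show "sorted_wrt (\<lambda>s t. tkey n w s < tkey n w t) (tokens_of k n w)"
    by (simp add: chunk_def)
  have "set (tokens (vert_shape n w v) v) \<subseteq> set (tokens_of k n w)" if "v \<in> cycle_verts n k" for v
    using tokens1_complete[OF assms(1) that] tokens2_complete[OF assms(1) that]
      tokens3_complete[OF assms(1) that] assms(2)
    unfolding tokens_of_def by (elim insertE) simp_all
  then show "set (tokens_of k n w) = (\<Union>v \<in> cycle_verts n k. set (tokens (vert_shape n w v) v))"
    using chunk unfolding chunk_def by blast
qed (use assms in auto)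

theorem proposition9p1:
  fixes n :: nat and k :: "nat \<Rightarrow> nat"
    and T :: "vert \<Rightarrow> 't rel" and \<rho> :: "vert \<Rightarrow> 't" and W :: "vert \<Rightarrow> 't tree_words"
  assumes "n \<ge> 4"
    and "\<And>v. v \<in> Field (cycle_poset n k) \<Longrightarrow> rooted_tree_poset (T v) (\<rho> v)"
    and "\<And>v. v \<in> Field (cycle_poset n k) \<Longrightarrow> admissible (T v) (\<rho> v) (W v)"
  shows "realizer (graft (cycle_poset n k) T \<rho>) [word1 k \<rho> W n, word2 k \<rho> W n, word3 k \<rho> W n]"
proof -
  have n: "1 \<le> n" using assms(1) by simp
  note Field = Field_cycle_poset[OF n, of k]
  note less = cycle_poset_iff[OF n, of _ _ k]
  have ws: "set [1, 2, 3 :: nat] = {1, 2, 3}" by simp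
  have "realizer (graft (cycle_poset n k) T \<rho>)
      (map (\<lambda>w. concat (map (spell \<rho> W) (tokens_of k n w))) [1, 2, 3])"
  proof (rule layouts_realize_graft[where shp = "vert_shape n" and lo = "vert_lo n" and hi = "vert_hi n"],
      unfold ws)
    show "layout (Field (cycle_poset n k)) T \<rho> W (vert_shape n w) (vert_lo n w) (vert_hi n w)
        (tokens_of k n w)" if "w \<in> {1, 2, 3}" for w
      unfolding Field by (rule layout_tokens[OF assms(1) that assms(2,3)[unfolded Field]])
    show "\<exists>w \<in> {1, 2, 3}. vert_shape n w v = s" if "v \<in> Field (cycle_poset n k)" for v s
    proof -
      have "distinct [vert_shape n 1 v, vert_shape n 2 v, vert_shape n 3 v]"
        using vert_shapes_distinct[OF assms(1)] that unfolding Field by blast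
      then show ?thesis
        by (cases s; cases "vert_shape n 1 v"; cases "vert_shape n 2 v"; cases "vert_shape n 3 v") auto
    qed
    show "\<exists>w \<in> {1, 2, 3}. vert_shape n w a \<noteq> Early \<and> vert_shape n w c \<noteq> Late"
      if "(a, c) \<in> cycle_poset n k" "a \<noteq> c" for a c
    proof -
      have "distinct [vert_shape n 1 a, vert_shape n 2 a, vert_shape n 3 a]"
        "distinct [vert_shape n 1 c, vert_shape n 2 c, vert_shape n 3 c]"
        using vert_shapes_distinct[OF assms(1)] that unfolding less by blast+
      then show ?thesis by auto
    qed
  next
    fix a c w assume "(a, c) \<in> cycle_poset n k" "a \<noteq> c" and w: "w \<in> {1, 2, 3 :: nat}"
    then have ac: "a \<in> cycle_verts n k" "c \<in> cycle_verts n k" "before n a c"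
      unfolding less by auto
    note keys = before_keys[OF assms(1) ac w]
    show "(if vert_shape n w a = Late then vert_hi n w a else vert_lo n w a) <
        (if vert_shape n w c = Late then vert_hi n w c else vert_lo n w c)"
      by (rule keys(1))
    show "vert_hi n w c < vert_hi n w a" if "vert_shape n w a = Early" by (rule keys(2)[OF that])
    show "vert_lo n w c < vert_lo n w a" if "vert_shape n w c = Late" by (rule keys(3)[OF that])
  next
    show "\<exists>w \<in> {1, 2, 3}. vert_hi n w a < vert_lo n w c"
      if "a \<in> Field (cycle_poset n k)" "c \<in> Field (cycle_poset n k)"
        "(a, c) \<notin> cycle_poset n k" "(c, a) \<notin> cycle_poset n k" for a c
      using that parallel_keys[OF assms(1), of a k c] unfolding Field less by blast
  qed (use assms(2,3) less Field in auto)
  then show ?thesis by (simp add: tokens_of_def spell_tokens)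
qed

end
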